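(* Let $\Gamma$ be a countable set. For each $\gamma\in\Gamma$ let $X_\gamma$ be an infinite-dimensional Banach function space over a complete $\sigma$-finite measure space $(\Omega_\gamma,\Sigma_\gamma,\mu_\gamma)$, and let $\mathcal{E}$ be a monotone complete Banach sequence space on $\Gamma$. Then the space $(\bigoplus_{\gamma\in\Gamma}X_\gamma)_{\mathcal{E}}$ has the property $\mathbf{H}(\textit{measure})$ if, and only if, (1) all the spaces $X_\gamma$ have the property $\mathbf{H}(\textit{measure})$; (2) the space $\mathcal{E}$ has the property $\mathbf{H}(\textit{point-wise})$; and (3) the space $\mathcal{E}$ is strictly monotone ($\mathbf{SM}$).
   Context: Banach spaces are real. Banach function space over $(\Omega,\Sigma,\mu)$: a Banach space $X$ of (equivalence classes of) real measurable, locally integrable functions on $\Omega$ such that (i) if $|f|\le|g|$ a.e., $f$ is measurable and $g\in X$, then $f\in X$ and $\|f\|\le\|g\|$; (ii) the characteristic function of every set of finite measure belongs to $X$. Banach sequence space on a countable set $\Gamma$: a Banach space $X$ that is a linear subspace of the space $\omega(\Gamma)$ of all real functions on $\Gamma$, contains the characteristic functions of all finite subsets of $\Gamma$, and has the ideal property: if $|x(\gamma)|\le|y(\gamma)|$ for all $\gamma$ and $y\in X$, then $x\in X$ and $\|x\|\le\|y\|$. It is monotone complete if every increasing sequence of positive functions from its closed unit ball converges point-wise to some element of $X$. It is strictly monotone ($\mathbf{SM}$) if $0\le y\le x$, $y\neq x$, $x,y\in X$ imply $\|y\|<\|x\|$. Direct sum: $(\bigoplus_{\gamma\in\Gamma}X_\gamma)_{\mathcal{E}}$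 is the Banach space of all $x=\{x(\gamma)\}_{\gamma\in\Gamma}\in\prod_{\gamma}X_\gamma$ with $\sum_{\gamma}\|x(\gamma)\|_{X_\gamma}\boldsymbol{e}_\gamma\in\mathcal{E}$ ($\boldsymbol{e}_\gamma$ the unit vectors), with norm $\|x\|=\big\|\sum_{\gamma}\|x(\gamma)\|_{X_\gamma}\boldsymbol{e}_\gamma\big\|_{\mathcal{E}}$. It is regarded as a linear subspace of $L_0(\Delta,\mathcal{A},m)$, where $\Delta=\bigsqcup_{\gamma}\Omega_\gamma$ is the disjoint union (with its natural $\sigma$-algebra $\mathcal{A}$) and $m(A)=\sum_{\gamma}\mu_\gamma(A\cap\Omega_\gamma)$. Local convergence in measure: $f_n\to f$ locally in measure on $(\Omega,\Sigma,\mu)$ if for every $\varepsilon>0$ and every $F\in\Sigma$ with $\mu(F)<\infty$, $\mu(\{\omega\in F:|f(\omega)-f_n(\omega)|\ge\varepsilon\})\to0$. This is convergence in a linear topology on $L_0(\Omega,\Sigma,\mu)$, inherited by subspaces; for the direct sum it is taken with respect to $m$. Kadets--Klee property: for a linear Hausdorff topology $\mathfrak{T}$ on a Banach space $X$ coarser than the norm topology, $X$ has $\mathbf{H}(\mathfrak{T})$ if whenever $x_n,x$ lie on the unit sphere of $X$ and $x_n\to x$ in $\mathfrak{T}$, then $\|x_n-x\|\to0$. $\mathbf{H}(\textit{measure})$ and $\mathbf{H}(\textit{point-wise})$ refer to the topology of local convergence in measure and the topology of point-wise convergence. *)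

theory Defs
  imports "HOL-Analysis.Analysis"
begin

section \<open>Banach spaces of real functions\<close>

text \<open>
  A Banach space whose elements are classes of functions is given by the set \<open>X\<close> of all
  representatives and the norm \<open>N\<close> as a function of a representative; \<open>null\<close> says which
  functions represent the zero vector.  Nonnegativity of \<open>N\<close> on \<open>X\<close> and invariance of \<open>N\<close> under
  adding a null function of \<open>X\<close> follow from the axioms.
\<close>

locale banach_space_of_functions =
  fixes "null" :: "('a \<Rightarrow> real) \<Rightarrow> bool"
    and X :: "('a \<Rightarrow> real) set"
    and N :: "('a \<Rightarrow> real) \<Rightarrow> real"
  assumes zero_mem: "(\<lambda>t. 0) \<in> X"
    and add_mem: "f \<in> X \<Longrightarrow> g \<in> X \<Longrightarrow> (\<lambda>t. f t + g t) \<in> X"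
    and scale_mem: "f \<in> X \<Longrightarrow> (\<lambda>t. c * f t) \<in> X"
    and norm_triangle: "f \<in> X \<Longrightarrow> g \<in> X \<Longrightarrow> N (\<lambda>t. f t + g t) \<le> N f + N g"
    and norm_scale: "f \<in> X \<Longrightarrow> N (\<lambda>t. c * f t) = \<bar>c\<bar> * N f"
    and norm_eq_zero_iff: "f \<in> X \<Longrightarrow> N f = 0 \<longleftrightarrow> null f"
    and complete:
      "(\<And>n. u n \<in> X) \<Longrightarrow>
       (\<And>e. e > 0 \<Longrightarrow> \<exists>K. \<forall>m\<ge>K. \<forall>n\<ge>K. N (\<lambda>t. u m t - u n t) < e) \<Longrightarrow>
       \<exists>f\<in>X. (\<lambda>n. N (\<lambda>t. u n t - f t)) \<longlonglongrightarrow> 0"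

definition locally_integrable :: "'a measure \<Rightarrow> ('a \<Rightarrow> real) \<Rightarrow> bool" where
  "locally_integrable M f \<longleftrightarrow>
     f \<in> borel_measurable M \<and> (\<forall>F\<in>sets M. emeasure M F < \<infinity> \<longrightarrow> set_integrable M F f)"

text \<open>
  By the ideal property, \<open>X\<close> contains with \<open>f\<close> every measurable function that is equal to \<open>f\<close>
  almost everywhere, so \<open>X\<close> is a union of equivalence classes.
\<close>

locale banach_function_space =
  banach_space_of_functions "\<lambda>f. AE t in M. f t = 0" X N
  for M :: "'a measure" and X :: "('a \<Rightarrow> real) set" and N :: "('a \<Rightarrow> real) \<Rightarrow> real" +
  assumes locally_integrable: "f \<in> X \<Longrightarrow> locally_integrable M f"
    and ideal_mem: "f \<in> borel_measurable M \<Longrightarrow> g \<in> X \<Longrightarrow> AE t in M. \<bar>f t\<bar> \<le> \<bar>g t\<bar> \<Longrightarrow> f \<in> X"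
    and ideal_norm: "f \<in> borel_measurable M \<Longrightarrow> g \<in> X \<Longrightarrow> AE t in M. \<bar>f t\<bar> \<le> \<bar>g t\<bar> \<Longrightarrow> N f \<le> N g"
    and indicator_mem: "F \<in> sets M \<Longrightarrow> emeasure M F < \<infinity> \<Longrightarrow> indicator F \<in> X"

definition infinite_dimensional_mod_AE :: "'a measure \<Rightarrow> ('a \<Rightarrow> real) set \<Rightarrow> bool" where
  "infinite_dimensional_mod_AE M X \<longleftrightarrow>
     \<not> (\<exists>B. finite B \<and> B \<subseteq> X \<and>
          (\<forall>f\<in>X. \<exists>c. AE t in M. f t = (\<Sum>b\<in>B. c b * b t)))"

text \<open>
  A real function on \<open>\<Gamma>\<close> is represented by its extension by \<open>0\<close> to the whole type, so that here
  every vector has exactly one representative.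
\<close>

locale banach_sequence_space =
  banach_space_of_functions "\<lambda>x. \<forall>\<gamma>. x \<gamma> = 0" E p
  for \<Gamma> :: "'i set" and E :: "('i \<Rightarrow> real) set" and p :: "('i \<Rightarrow> real) \<Rightarrow> real" +
  assumes countable_index: "countable \<Gamma>"
    and support: "x \<in> E \<Longrightarrow> \<gamma> \<notin> \<Gamma> \<Longrightarrow> x \<gamma> = 0"
    and indicator_mem: "finite F \<Longrightarrow> F \<subseteq> \<Gamma> \<Longrightarrow> indicator F \<in> E"
    and ideal_mem:
      "(\<And>\<gamma>. \<gamma> \<notin> \<Gamma> \<Longrightarrow> x \<gamma> = 0) \<Longrightarrow> y \<in> E \<Longrightarrow> (\<And>\<gamma>. \<gamma> \<in> \<Gamma> \<Longrightarrow> \<bar>x \<gamma>\<bar> \<le> \<bar>y \<gamma>\<bar>) \<Longrightarrow> x \<in> E"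
    and ideal_norm:
      "(\<And>\<gamma>. \<gamma> \<notin> \<Gamma> \<Longrightarrow> x \<gamma> = 0) \<Longrightarrow> y \<in> E \<Longrightarrow> (\<And>\<gamma>. \<gamma> \<in> \<Gamma> \<Longrightarrow> \<bar>x \<gamma>\<bar> \<le> \<bar>y \<gamma>\<bar>) \<Longrightarrow> p x \<le> p y"

definition monotone_complete :: "('i \<Rightarrow> real) set \<Rightarrow> (('i \<Rightarrow> real) \<Rightarrow> real) \<Rightarrow> bool" where
  "monotone_complete E p \<longleftrightarrow>
     (\<forall>u. (\<forall>n. u n \<in> E \<and> p (u n) \<le> 1 \<and> (\<forall>\<gamma>. 0 \<le> u n \<gamma>)) \<and>
          (\<forall>n \<gamma>. u n \<gamma> \<le> u (Suc n) \<gamma>) \<longrightarrow>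
          (\<exists>x\<in>E. \<forall>\<gamma>. (\<lambda>n. u n \<gamma>) \<longlonglongrightarrow> x \<gamma>))"

definition strictly_monotone :: "('i \<Rightarrow> real) set \<Rightarrow> (('i \<Rightarrow> real) \<Rightarrow> real) \<Rightarrow> bool" where
  "strictly_monotone E p \<longleftrightarrow>
     (\<forall>x\<in>E. \<forall>y\<in>E. (\<forall>\<gamma>. 0 \<le> y \<gamma> \<and> y \<gamma> \<le> x \<gamma>) \<and> y \<noteq> x \<longrightarrow> p y < p x)"


section \<open>Kadets--Klee properties\<close>

definition tendsto_locally_in_measure ::
    "'a measure \<Rightarrow> (nat \<Rightarrow> 'a \<Rightarrow> real) \<Rightarrow> ('a \<Rightarrow> real) \<Rightarrow> bool" where
  "tendsto_locally_in_measure M u f \<longleftrightarrow>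
     (\<forall>\<epsilon>>0. \<forall>F\<in>sets M. emeasure M F < \<infinity> \<longrightarrow>
        (\<lambda>n. emeasure M {t\<in>F. \<bar>f t - u n t\<bar> \<ge> \<epsilon>}) \<longlonglongrightarrow> 0)"

definition tendsto_pointwise :: "(nat \<Rightarrow> 'i \<Rightarrow> real) \<Rightarrow> ('i \<Rightarrow> real) \<Rightarrow> bool" where
  "tendsto_pointwise u x \<longleftrightarrow> (\<forall>\<gamma>. (\<lambda>n. u n \<gamma>) \<longlonglongrightarrow> x \<gamma>)"

text \<open>
  The property \<open>H(\<TT>)\<close> involves the topology \<open>\<TT>\<close> only through its convergent sequences, so
  \<open>\<TT>\<close> enters as the relation \<open>conv u f\<close>: the sequence \<open>u\<close> converges to \<open>f\<close> in \<open>\<TT>\<close>.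
\<close>

definition kadets_klee ::
    "((nat \<Rightarrow> 'a \<Rightarrow> real) \<Rightarrow> ('a \<Rightarrow> real) \<Rightarrow> bool) \<Rightarrow>
     ('a \<Rightarrow> real) set \<Rightarrow> (('a \<Rightarrow> real) \<Rightarrow> real) \<Rightarrow> bool" where
  "kadets_klee conv X N \<longleftrightarrow>
     (\<forall>u f. (\<forall>n. u n \<in> X \<and> N (u n) = 1) \<and> f \<in> X \<and> N f = 1 \<and> conv u f \<longrightarrow>
            (\<lambda>n. N (\<lambda>t. u n t - f t)) \<longlonglongrightarrow> 0)"

abbreviation H_measure ::
    "'a measure \<Rightarrow> ('a \<Rightarrow> real) set \<Rightarrow> (('a \<Rightarrow> real) \<Rightarrow> real) \<Rightarrow> bool" where
  "H_measure M \<equiv> kadets_klee (tendsto_locally_in_measure M)"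

abbreviation H_pointwise :: "('i \<Rightarrow> real) set \<Rightarrow> (('i \<Rightarrow> real) \<Rightarrow> real) \<Rightarrow> bool" where
  "H_pointwise \<equiv> kadets_klee tendsto_pointwise"


section \<open>Direct sums\<close>

definition disjoint_union_measure :: "'i set \<Rightarrow> ('i \<Rightarrow> 'a measure) \<Rightarrow> ('i \<times> 'a) measure" where
  "disjoint_union_measure \<Gamma> M =
     measure_of (SIGMA \<gamma>:\<Gamma>. space (M \<gamma>))
       {A. A \<subseteq> (SIGMA \<gamma>:\<Gamma>. space (M \<gamma>)) \<and> (\<forall>\<gamma>\<in>\<Gamma>. Pair \<gamma> -` A \<in> sets (M \<gamma>))}
       (\<lambda>A. \<integral>\<^sup>+\<gamma>. emeasure (M \<gamma>) (Pair \<gamma> -` A) \<partial>count_space \<Gamma>)"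

text \<open>
  A family \<open>x(\<gamma>)\<close> is represented by the single function \<open>(\<gamma>, t) \<mapsto> x(\<gamma>)(t)\<close> on the disjoint union;
  \<open>sum_norms\<close> is the scalar family \<open>\<Sum>\<^sub>\<gamma> \<parallel>x(\<gamma>)\<parallel> e\<^sub>\<gamma>\<close>.
\<close>

definition sum_norms ::
    "'i set \<Rightarrow> ('i \<Rightarrow> ('a \<Rightarrow> real) \<Rightarrow> real) \<Rightarrow> ('i \<times> 'a \<Rightarrow> real) \<Rightarrow> 'i \<Rightarrow> real" where
  "sum_norms \<Gamma> N x = (\<lambda>\<gamma>. if \<gamma> \<in> \<Gamma> then N \<gamma> (\<lambda>t. x (\<gamma>, t)) else 0)"

definition direct_sum ::
    "'i set \<Rightarrow> ('i \<Rightarrow> ('a \<Rightarrow> real) set) \<Rightarrow> ('i \<Rightarrow> ('a \<Rightarrow> real) \<Rightarrow> real) \<Rightarrow>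
     ('i \<Rightarrow> real) set \<Rightarrow> ('i \<times> 'a \<Rightarrow> real) set" where
  "direct_sum \<Gamma> X N E =
     {x. (\<forall>\<gamma>\<in>\<Gamma>. (\<lambda>t. x (\<gamma>, t)) \<in> X \<gamma>) \<and> sum_norms \<Gamma> N x \<in> E}"

definition direct_sum_norm ::
    "'i set \<Rightarrow> ('i \<Rightarrow> ('a \<Rightarrow> real) \<Rightarrow> real) \<Rightarrow> (('i \<Rightarrow> real) \<Rightarrow> real) \<Rightarrow>
     ('i \<times> 'a \<Rightarrow> real) \<Rightarrow> real" where
  "direct_sum_norm \<Gamma> N p x = p (sum_norms \<Gamma> N x)"

lemma sigma_algebra_disjoint_union:
  "sigma_algebra (SIGMA \<gamma>:\<Gamma>. space (M \<gamma>))
     {A. A \<subseteq> (SIGMA \<gamma>:\<Gamma>. space (M \<gamma>)) \<and> (\<forall>\<gamma>\<in>\<Gamma>. Pair \<gamma> -` A \<in> sets (M \<gamma>))}"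
proof -
  have diff: "Pair \<gamma> -` ((SIGMA \<gamma>:\<Gamma>. space (M \<gamma>)) - A) = space (M \<gamma>) - Pair \<gamma> -` A"
    if "\<gamma> \<in> \<Gamma>" for \<gamma> A using that by auto
  show ?thesis
    unfolding sigma_algebra_iff2 by (auto simp: diff vimage_UN)
qed

lemma space_disjoint_union_measure:
  "space (disjoint_union_measure \<Gamma> M) = (SIGMA \<gamma>:\<Gamma>. space (M \<gamma>))"
  unfolding disjoint_union_measure_def by (rule space_measure_of) auto

lemma sets_disjoint_union_measure:
  "sets (disjoint_union_measure \<Gamma> M) =
     {A. A \<subseteq> (SIGMA \<gamma>:\<Gamma>. space (M \<gamma>)) \<and> (\<forall>\<gamma>\<in>\<Gamma>. Pair \<gamma> -` A \<in> sets (M \<gamma>))}"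
  unfolding disjoint_union_measure_def
  by (rule sigma_algebra.sets_measure_of_eq[OF sigma_algebra_disjoint_union])

lemma emeasure_disjoint_union_measure:
  fixes \<Gamma> :: "'i set" and M :: "'i \<Rightarrow> 'a measure"
  assumes A: "A \<in> sets (disjoint_union_measure \<Gamma> M)"
  shows "emeasure (disjoint_union_measure \<Gamma> M) A =
           (\<integral>\<^sup>+\<gamma>. emeasure (M \<gamma>) (Pair \<gamma> -` A) \<partial>count_space \<Gamma>)"
  unfolding disjoint_union_measure_def
proof (rule emeasure_measure_of_sigma[OF sigma_algebra_disjoint_union])
  let ?S = "{A. A \<subseteq> (SIGMA \<gamma>:\<Gamma>. space (M \<gamma>)) \<and> (\<forall>\<gamma>\<in>\<Gamma>. Pair \<gamma> -` A \<in> sets (M \<gamma>))}"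
  let ?m = "\<lambda>A. \<integral>\<^sup>+\<gamma>. emeasure (M \<gamma>) (Pair \<gamma> -` A) \<partial>count_space \<Gamma>"
  show "positive ?S ?m" by (simp add: positive_def)
  show "countably_additive ?S ?m"
  proof (rule countably_additiveI)
    fix B :: "nat \<Rightarrow> ('i \<times> 'a) set"
    assume B: "range B \<subseteq> ?S" "disjoint_family B"
    have "(\<Sum>n. emeasure (M \<gamma>) (Pair \<gamma> -` B n)) = emeasure (M \<gamma>) (Pair \<gamma> -` (\<Union>n. B n))"
      if "\<gamma> \<in> \<Gamma>" for \<gamma>
    proof -
      have "disjoint_family (\<lambda>n. Pair \<gamma> -` B n)"
        using B(2) by (auto simp: disjoint_family_on_def)
      then show ?thesis
        using B(1) that by (subst suminf_emeasure) (auto simp: vimage_UN)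
    qed
    then have "?m (\<Union>n. B n) = (\<integral>\<^sup>+\<gamma>. (\<Sum>n. emeasure (M \<gamma>) (Pair \<gamma> -` B n)) \<partial>count_space \<Gamma>)"
      by (intro nn_integral_cong) simp
    also have "\<dots> = (\<Sum>n. ?m (B n))"
      by (rule nn_integral_suminf) simp
    finally show "(\<Sum>n. ?m (B n)) = ?m (\<Union>n. B n)" ..
  qed
  show "A \<in> ?S" using A unfolding sets_disjoint_union_measure .
qed

lemma direct_sum_subset_borel_measurable:
  assumes "\<And>\<gamma>. \<gamma> \<in> \<Gamma> \<Longrightarrow> banach_function_space (M \<gamma>) (X \<gamma>) (N \<gamma>)"
  shows "direct_sum \<Gamma> X N E \<subseteq> borel_measurable (disjoint_union_measure \<Gamma> M)"
proof
  fix x assume x: "x \<in> direct_sum \<Gamma> X N E"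
  show "x \<in> borel_measurable (disjoint_union_measure \<Gamma> M)"
  proof (rule measurableI)
    fix B :: "real set" assume B: "B \<in> sets borel"
    have "Pair \<gamma> -` (x -` B \<inter> (SIGMA \<gamma>:\<Gamma>. space (M \<gamma>))) \<in> sets (M \<gamma>)" if \<gamma>: "\<gamma> \<in> \<Gamma>" for \<gamma>
    proof -
      have "(\<lambda>t. x (\<gamma>, t)) \<in> borel_measurable (M \<gamma>)"
        using x \<gamma> banach_function_space.locally_integrable[OF assms[OF \<gamma>]]
        by (auto simp: direct_sum_def locally_integrable_def)
      from measurable_sets[OF this B]
      show ?thesis using \<gamma> by (simp add: vimage_def Int_def conj_commute)
    qed
    then show "x -` B \<inter> space (disjoint_union_measure \<Gamma> M) \<in> sets (disjoint_union_measure \<Gamma> M)"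
      by (auto simp: space_disjoint_union_measure sets_disjoint_union_measure)
  qed simp
qed

end

theory Submission
  imports Defs
begin

text \<open>
  The idea behind both directions is that a sign flip is invisible to an ideal norm: if \<open>h\<close> is
  obtained from \<open>f\<close> by changing the sign on a set \<open>A\<close>, then \<open>\<bar>h\<bar> = \<bar>f\<bar>\<close>, so \<open>h\<close> and \<open>f\<close> have the
  same norm.  If the sets \<open>A\<^sub>n\<close> vanish in the weak topology under consideration, the flipped
  functions converge to \<open>f\<close>, and the Kadets--Klee property forces the part of \<open>f\<close> on \<open>A\<^sub>n\<close> to tend
  to zero in norm.  Hence a space with this property has a dominated convergence theorem for its
  norm (\<open>kadets_klee_dominated\<close>), and its norm is lower semicontinuous for the weak
  convergence (\<open>kadets_klee_norm_lower_semicontinuous\<close>).  Both facts hold for function spaces with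
  convergence in measure and for sequence spaces with pointwise convergence, with one proof.

  Sufficiency.  Let \<open>u\<^sub>n \<longlonglongrightarrow> f\<close> in measure on the unit sphere of the sum, and let \<open>a\<^sub>n\<close>, \<open>b\<close> be the
  families of component norms.  Lower semicontinuity in the components gives \<open>liminf a\<^sub>n \<ge> b\<close>
  pointwise.  If \<open>a\<^sub>n(\<gamma>\<^sub>0) \<ge> b(\<gamma>\<^sub>0) + \<epsilon>\<close> for infinitely many \<open>n\<close>, then along these \<open>n\<close> the excess of
  \<open>w = b + \<epsilon> e\<^bsub>\<gamma>\<^sub>0\<^esub>\<close> over \<open>a\<^sub>n\<close> tends to zero, in norm by domination, so
  \<open>\<parallel>w\<parallel> \<le> 1 = \<parallel>b\<parallel>\<close>, against strict monotonicity.  So \<open>a\<^sub>n \<longlonglongrightarrow> b\<close> pointwise, hence in norm; each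
  component of \<open>u\<^sub>n - f\<close> tends to zero in norm; and the family of the norms of these components is
  at most \<open>\<bar>a\<^sub>n - b\<bar>\<close> plus a sequence dominated by \<open>2 b\<close>, which dominated convergence handles.

  Necessity.  Each component, and the index space with the help of unit vectors of the components,
  embeds isometrically in the sum and compatibly with the convergences.  For strict monotonicity,
  an infinite-dimensional component carries positive unit vectors with disjoint supports, which
  tend to zero in measure (\<open>null_sequence_of_unit_vectors\<close>).  If lowering one coordinate of a
  positive family by \<open>d\<close> leaves its norm unchanged, then adding \<open>d\<close> times these vectors to the lowered
  vector gives a sequence on the same sphere that converges in measure but not in norm.
\<close>

section \<open>Local convergence in measure\<close>

lemma tendsto_locally_in_measureD:
  assumes "tendsto_locally_in_measure M u f" "e > 0" "F \<in> sets M" "emeasure M F < \<infinity>"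
  shows "(\<lambda>n. emeasure M {t\<in>F. \<bar>f t - u n t\<bar> \<ge> e}) \<longlonglongrightarrow> 0"
  using assms unfolding tendsto_locally_in_measure_def by blast

lemma tendsto_locally_in_measure_pointwise:
  assumes u: "\<And>n. u n \<in> borel_measurable M" and f: "f \<in> borel_measurable M"
    and lim: "\<And>t. t \<in> space M \<Longrightarrow> (\<lambda>n. u n t) \<longlonglongrightarrow> f t"
  shows "tendsto_locally_in_measure M u f"
  unfolding tendsto_locally_in_measure_def
proof (intro allI impI ballI)
  fix e :: real and F assume e: "e > 0" and F: "F \<in> sets M" and fin: "emeasure M F < \<infinity>"
  note [measurable] = u f F
  have F_sub: "F \<subseteq> space M" using F by (rule sets.sets_into_space)
  have S[measurable]: "{t\<in>F. \<bar>f t - u n t\<bar> \<ge> e} \<in> sets M" for n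
  proof -
    have "{t\<in>F. \<bar>f t - u n t\<bar> \<ge> e} = {t\<in>space M. t \<in> F \<and> \<bar>f t - u n t\<bar> \<ge> e}"
      using F_sub by auto
    then show ?thesis by simp
  qed
  have "(\<lambda>n. \<integral>\<^sup>+t. indicator {t\<in>F. \<bar>f t - u n t\<bar> \<ge> e} t \<partial>M) \<longlonglongrightarrow> (\<integral>\<^sup>+t. 0 \<partial>M)"
  proof (rule nn_integral_dominated_convergence)
    show "(\<integral>\<^sup>+t. indicator F t \<partial>M) < \<infinity>" using fin F by simp
    show "AE t in M. (\<lambda>n. indicator {t\<in>F. \<bar>f t - u n t\<bar> \<ge> e} t :: ennreal) \<longlonglongrightarrow> 0"
    proof (rule AE_I2)
      fix t assume "t \<in> space M"
      from tendstoD[OF lim[OF this] e]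
      have "eventually (\<lambda>n. (indicator {t\<in>F. \<bar>f t - u n t\<bar> \<ge> e} t :: ennreal) = 0) sequentially"
        by eventually_elim (auto simp: dist_real_def abs_minus_commute)
      then show "(\<lambda>n. indicator {t\<in>F. \<bar>f t - u n t\<bar> \<ge> e} t :: ennreal) \<longlonglongrightarrow> 0"
        by (rule tendsto_eventually)
    qed
  qed (auto simp: indicator_def)
  then show "(\<lambda>n. emeasure M {t\<in>F. \<bar>f t - u n t\<bar> \<ge> e}) \<longlonglongrightarrow> 0"
    by simp
qed

lemma measurable_deviation_set:
  assumes "g \<in> borel_measurable M" "f \<in> borel_measurable M" "F \<in> sets M"
  shows "{t\<in>F. \<bar>f t - g t :: real\<bar> \<ge> e} \<in> sets M"
proof -
  note [measurable] = assms
  have "{t\<in>F. \<bar>f t - g t\<bar> \<ge> e} = {t\<in>space M. t \<in> F \<and> \<bar>f t - g t\<bar> \<ge> e}"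
    using sets.sets_into_space[OF assms(3)] by auto
  then show ?thesis by simp
qed

lemma tendsto_locally_in_measure_add:
  assumes meas: "\<And>n. u n \<in> borel_measurable M" "f \<in> borel_measurable M"
    "\<And>n. v n \<in> borel_measurable M" "g \<in> borel_measurable M"
    and u: "tendsto_locally_in_measure M u f" and v: "tendsto_locally_in_measure M v g"
  shows "tendsto_locally_in_measure M (\<lambda>n t. u n t + v n t) (\<lambda>t. f t + g t)"
  unfolding tendsto_locally_in_measure_def
proof (intro allI impI ballI)
  fix e :: real and F assume e: "e > 0" and F: "F \<in> sets M" and fin: "emeasure M F < \<infinity>"
  let ?A = "\<lambda>n. {t\<in>F. \<bar>f t - u n t\<bar> \<ge> e / 2}" and ?B = "\<lambda>n. {t\<in>F. \<bar>g t - v n t\<bar> \<ge> e / 2}"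
  have A: "?A n \<in> sets M" and B: "?B n \<in> sets M" for n
    using meas F by (auto intro!: measurable_deviation_set)
  have "(\<lambda>n. emeasure M (?A n) + emeasure M (?B n)) \<longlonglongrightarrow> 0 + 0"
    using u v F fin e by (intro tendsto_add tendsto_locally_in_measureD) auto
  then have lim: "(\<lambda>n. emeasure M (?A n) + emeasure M (?B n)) \<longlonglongrightarrow> 0" by simp
  have le: "emeasure M {t\<in>F. \<bar>f t + g t - (u n t + v n t)\<bar> \<ge> e}
      \<le> emeasure M (?A n) + emeasure M (?B n)" for n
  proof -
    have "emeasure M {t\<in>F. \<bar>f t + g t - (u n t + v n t)\<bar> \<ge> e} \<le> emeasure M (?A n \<union> ?B n)"
    proof (rule emeasure_mono)
      have "e \<le> 2 * \<bar>f t - u n t\<bar> \<or> e \<le> 2 * \<bar>g t - v n t\<bar>"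
        if "e \<le> \<bar>f t + g t - (u n t + v n t)\<bar>" for t
      proof -
        have "\<bar>f t + g t - (u n t + v n t)\<bar> \<le> \<bar>f t - u n t\<bar> + \<bar>g t - v n t\<bar>"
          using abs_triangle_ineq[of "f t - u n t" "g t - v n t"] by (simp add: algebra_simps)
        with that show ?thesis by argo
      qed
      then show "{t\<in>F. \<bar>f t + g t - (u n t + v n t)\<bar> \<ge> e} \<subseteq> ?A n \<union> ?B n"
        by (fastforce simp: field_simps)
    qed (use A B in auto)
    also have "\<dots> \<le> emeasure M (?A n) + emeasure M (?B n)"
      using A B by (rule emeasure_subadditive)
    finally show ?thesis .
  qed
  show "(\<lambda>n. emeasure M {t\<in>F. \<bar>f t + g t - (u n t + v n t)\<bar> \<ge> e}) \<longlonglongrightarrow> 0"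
    by (rule tendsto_sandwich[OF _ _ tendsto_const lim]) (intro always_eventually allI le zero_le)+
qed

lemma tendsto_locally_in_measure_le:
  assumes meas: "\<And>n. u n \<in> borel_measurable M" "f \<in> borel_measurable M"
    and u: "tendsto_locally_in_measure M u f"
    and C: "C > 0"
    and le: "\<And>n t. \<bar>g t - w n t\<bar> \<le> C * \<bar>f t - u n t\<bar>"
  shows "tendsto_locally_in_measure M w g"
  unfolding tendsto_locally_in_measure_def
proof (intro allI impI ballI)
  fix e :: real and F assume e: "e > 0" and F: "F \<in> sets M" and fin: "emeasure M F < \<infinity>"
  let ?A = "\<lambda>n. {t\<in>F. \<bar>f t - u n t\<bar> \<ge> e / C}"
  have lim: "(\<lambda>n. emeasure M (?A n)) \<longlonglongrightarrow> 0"
    using u F fin e C by (intro tendsto_locally_in_measureD) auto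
  have le: "emeasure M {t\<in>F. \<bar>g t - w n t\<bar> \<ge> e} \<le> emeasure M (?A n)" for n
  proof (rule emeasure_mono)
    show "?A n \<in> sets M" using meas F by (auto intro!: measurable_deviation_set)
    have "e / C \<le> \<bar>f t - u n t\<bar>" if "e \<le> \<bar>g t - w n t\<bar>" for t
      using order_trans[OF that le[of t n]] C by (simp add: field_simps)
    then show "{t\<in>F. \<bar>g t - w n t\<bar> \<ge> e} \<subseteq> ?A n" by auto
  qed
  show "(\<lambda>n. emeasure M {t\<in>F. \<bar>g t - w n t\<bar> \<ge> e}) \<longlonglongrightarrow> 0"
    by (rule tendsto_sandwich[OF _ _ tendsto_const lim]) (intro always_eventually allI le zero_le)+
qed

lemma tendsto_locally_in_measure_shift:
  assumes "tendsto_locally_in_measure M u f"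
  shows "tendsto_locally_in_measure M (\<lambda>n. u (n + k)) f"
  using assms unfolding tendsto_locally_in_measure_def
  by (auto intro: LIMSEQ_ignore_initial_segment)

lemma tendsto_locally_in_measure_scale:
  assumes meas: "\<And>n. u n \<in> borel_measurable M" "f \<in> borel_measurable M"
    and u: "tendsto_locally_in_measure M u f" and c: "c \<longlonglongrightarrow> c0"
  shows "tendsto_locally_in_measure M (\<lambda>n t. c n * u n t) (\<lambda>t. c0 * f t)"
proof -
  note [measurable] = meas
  obtain C where C: "C > 0" "\<And>n. \<bar>c n\<bar> \<le> C"
    using convergent_imp_Bseq[OF convergentI[OF c]] by (auto simp: Bseq_def)
  \<comment> \<open>Split \<open>c\<^sub>n u\<^sub>n\<close> as \<open>c\<^sub>n (u\<^sub>n - f) + c\<^sub>n f\<close>: the first part is controlled by the bound of \<open>c\<close>,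
    and the second one converges at every point.\<close>
  have 1: "tendsto_locally_in_measure M (\<lambda>n t. c n * (u n t - f t)) (\<lambda>t. 0)"
  proof (rule tendsto_locally_in_measure_le[OF meas u C(1)])
    fix n t
    show "\<bar>0 - c n * (u n t - f t)\<bar> \<le> C * \<bar>f t - u n t\<bar>"
      using mult_right_mono[OF C(2)[of n], of "\<bar>f t - u n t\<bar>"]
      by (simp add: abs_mult abs_minus_commute)
  qed
  have 2: "tendsto_locally_in_measure M (\<lambda>n t. c n * f t) (\<lambda>t. c0 * f t)"
    using c by (intro tendsto_locally_in_measure_pointwise tendsto_mult tendsto_const) auto
  have "tendsto_locally_in_measure M (\<lambda>n t. c n * (u n t - f t) + c n * f t) (\<lambda>t. 0 + c0 * f t)"
    by (rule tendsto_locally_in_measure_add[OF _ _ _ _ 1 2]) auto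
  then show ?thesis by (simp add: algebra_simps)
qed

text \<open>
  A flipped point at which \<open>f\<close> has moved by at least \<open>d\<close> satisfies \<open>\<bar>f\<bar> \<ge> d / 2\<close>, hence
  \<open>\<bar>v\<^sub>n\<bar> \<ge> e d / 2\<close>; flips where \<open>f\<close> is small are harmless.
\<close>

lemma tendsto_locally_in_measure_sign_flip:
  assumes v: "\<And>n. v n \<in> borel_measurable M" and f: "f \<in> borel_measurable M"
    and lim: "tendsto_locally_in_measure M v (\<lambda>t. 0)" and e: "e > 0"
  shows "tendsto_locally_in_measure M (\<lambda>n t. if e * \<bar>f t\<bar> \<le> \<bar>v n t\<bar> then - f t else f t) f"
  unfolding tendsto_locally_in_measure_def
proof (intro allI impI ballI)
  fix d :: real and F assume d: "d > 0" and F: "F \<in> sets M" and fin: "emeasure M F < \<infinity>"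
  let ?h = "\<lambda>n t. if e * \<bar>f t\<bar> \<le> \<bar>v n t\<bar> then - f t else f t"
  let ?B = "\<lambda>n. {t\<in>F. \<bar>0 - v n t\<bar> \<ge> e * (d / 2)}"
  have B: "(\<lambda>n. emeasure M (?B n)) \<longlonglongrightarrow> 0"
    using lim F fin e d by (intro tendsto_locally_in_measureD) auto
  have le: "emeasure M {t\<in>F. \<bar>f t - ?h n t\<bar> \<ge> d} \<le> emeasure M (?B n)" for n
  proof (rule emeasure_mono)
    show "?B n \<in> sets M" using v F by (intro measurable_deviation_set) auto
    show "{t\<in>F. \<bar>f t - ?h n t\<bar> \<ge> d} \<subseteq> ?B n"
    proof
      fix t assume "t \<in> {t\<in>F. \<bar>f t - ?h n t\<bar> \<ge> d}"
      then have t: "t \<in> F" "d \<le> \<bar>f t - ?h n t\<bar>" by auto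
      then have 1: "e * \<bar>f t\<bar> \<le> \<bar>v n t\<bar>" and 2: "d / 2 \<le> \<bar>f t\<bar>"
        using d by (auto split: if_splits)
      from 2 e have "e * (d / 2) \<le> e * \<bar>f t\<bar>" by (intro mult_left_mono) auto
      with 1 t show "t \<in> ?B n" by auto
    qed
  qed
  show "(\<lambda>n. emeasure M {t\<in>F. \<bar>f t - ?h n t\<bar> \<ge> d}) \<longlonglongrightarrow> 0"
    by (rule tendsto_sandwich[OF _ _ tendsto_const B]) (intro always_eventually allI le zero_le)+
qed

section \<open>The norm along convergent sequences\<close>

lemma (in banach_space_of_functions) norm_nonneg:
  assumes "f \<in> X"
  shows "0 \<le> N f"
proof -
  have "N (\<lambda>t. 0 * f t) = 0" using norm_scale[OF assms, of 0] by simp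
  moreover have "N (\<lambda>t. f t + (-1) * f t) \<le> N f + N (\<lambda>t. (-1) * f t)"
    by (rule norm_triangle[OF assms scale_mem[OF assms]])
  ultimately show ?thesis using norm_scale[OF assms, of "-1"] by simp
qed

lemma (in banach_space_of_functions) norm_zero: "N (\<lambda>t. 0) = 0"
  using norm_scale[OF zero_mem, of 0] by simp

lemma (in banach_space_of_functions) diff_mem:
  "f \<in> X \<Longrightarrow> g \<in> X \<Longrightarrow> (\<lambda>t. f t - g t) \<in> X"
  using add_mem[OF _ scale_mem[of g "-1"]] by simp

lemma (in banach_space_of_functions) norm_diff_triangle:
  "f \<in> X \<Longrightarrow> g \<in> X \<Longrightarrow> N (\<lambda>t. f t - g t) \<le> N f + N g"
  using norm_triangle[OF _ scale_mem[of g "-1"]] norm_scale[of g "-1"] by simp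

text \<open>
  The common ground of function spaces with local convergence in measure and sequence spaces with
  pointwise convergence.  \<open>S\<close> is the ambient space in which \<open>X\<close> is an ideal (the measurable
  functions, or the functions that vanish off the index set), and \<open>conv\<close> is the weak convergence.
  The closure conditions list exactly the functions formed in the sign flip argument and in
  truncation.
\<close>

locale normed_function_ideal = banach_space_of_functions Z X N
  for Z :: "('a \<Rightarrow> real) \<Rightarrow> bool" and X :: "('a \<Rightarrow> real) set" and N :: "('a \<Rightarrow> real) \<Rightarrow> real" +
  fixes S :: "('a \<Rightarrow> real) set"
    and conv :: "(nat \<Rightarrow> 'a \<Rightarrow> real) \<Rightarrow> ('a \<Rightarrow> real) \<Rightarrow> bool"
  assumes subset: "X \<subseteq> S"
    and solid: "f \<in> S \<Longrightarrow> g \<in> X \<Longrightarrow> (\<And>t. \<bar>f t\<bar> \<le> \<bar>g t\<bar>) \<Longrightarrow> f \<in> X \<and> N f \<le> N g"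
    and abs_diff_mem: "f \<in> S \<Longrightarrow> g \<in> S \<Longrightarrow> (\<lambda>t. \<bar>f t - g t\<bar>) \<in> S"
    and excess_mem: "f \<in> S \<Longrightarrow> g \<in> S \<Longrightarrow> (\<lambda>t. max 0 (\<bar>f t\<bar> - \<bar>g t\<bar>)) \<in> S"
    and flip_mem: "f \<in> S \<Longrightarrow> g \<in> S \<Longrightarrow> (\<lambda>t. if e * \<bar>f t\<bar> \<le> \<bar>g t\<bar> then - f t else f t) \<in> S"
    and conv_shift: "conv u f \<Longrightarrow> conv (\<lambda>n. u (n + k)) f"
    and conv_scale: "(\<And>n. u n \<in> S) \<Longrightarrow> f \<in> S \<Longrightarrow> conv u f \<Longrightarrow> c \<longlonglongrightarrow> c0 \<Longrightarrow>
      conv (\<lambda>n t. c n * u n t) (\<lambda>t. c0 * f t)"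
    and conv_excess: "(\<And>n. u n \<in> S) \<Longrightarrow> f \<in> S \<Longrightarrow> conv u f \<Longrightarrow>
      conv (\<lambda>n t. max 0 (\<bar>f t\<bar> - \<bar>u n t\<bar>)) (\<lambda>t. 0)"
    and conv_flip: "(\<And>n. v n \<in> S) \<Longrightarrow> f \<in> S \<Longrightarrow> conv v (\<lambda>t. 0) \<Longrightarrow> e > 0 \<Longrightarrow>
      conv (\<lambda>n t. if e * \<bar>f t\<bar> \<le> \<bar>v n t\<bar> then - f t else f t) f"
begin

lemma abs_mem: "f \<in> X \<Longrightarrow> (\<lambda>t. \<bar>f t\<bar>) \<in> X"
  using solid[of "\<lambda>t. \<bar>f t\<bar>" f] abs_diff_mem[of f "\<lambda>t. 0"] subset zero_mem by auto

lemma norm_abs_le: "f \<in> X \<Longrightarrow> N (\<lambda>t. \<bar>f t\<bar>) \<le> N f"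
  using solid[of "\<lambda>t. \<bar>f t\<bar>" f] abs_diff_mem[of f "\<lambda>t. 0"] subset zero_mem by auto

text \<open>The Kadets--Klee property freed from the unit sphere, by normalising.\<close>

lemma kadets_klee_norm_tendsto:
  assumes H: "kadets_klee conv X N" and u: "\<And>n. u n \<in> X" and f: "f \<in> X"
    and conv: "conv u f" and lim: "(\<lambda>n. N (u n)) \<longlonglongrightarrow> N f"
  shows "(\<lambda>n. N (\<lambda>t. u n t - f t)) \<longlonglongrightarrow> 0"
proof (cases "N f = 0")
  case True
  then have bound: "(\<lambda>n. N (u n) + N f) \<longlonglongrightarrow> 0" using tendsto_add[OF lim tendsto_const[of "N f"]] by simp
  show ?thesis
    by (rule tendsto_sandwich[OF _ _ tendsto_const bound])
      (use u f norm_nonneg diff_mem norm_diff_triangle in auto)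
next
  case False
  with norm_nonneg[OF f] have pos: "0 < N f" by simp
  from order_tendstoD(1)[OF lim pos] obtain k where k: "\<And>n. n \<ge> k \<Longrightarrow> 0 < N (u n)"
    by (auto simp: eventually_sequentially)
  \<comment> \<open>The shift by \<open>k\<close> discards the finitely many \<open>u\<^sub>n\<close> that may vanish and cannot be normalised.\<close>
  define c where "c n = inverse (N (u (n + k)))" for n
  define c0 where "c0 = inverse (N f)"
  have lim': "(\<lambda>n. N (u (n + k))) \<longlonglongrightarrow> N f" using lim by (rule LIMSEQ_ignore_initial_segment)
  have c: "c \<longlonglongrightarrow> c0" unfolding c_def c0_def using lim' False by (rule tendsto_inverse)
  have cp: "c n > 0" "c n * N (u (n + k)) = 1" for n using k[of "n + k"] by (auto simp: c_def)
  have c0p: "c0 > 0" "c0 * N f = 1" using pos by (auto simp: c0_def)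
  have "conv (\<lambda>n t. c n * u (n + k) t) (\<lambda>t. c0 * f t)"
    using u f subset c by (intro conv_scale conv_shift conv) auto
  moreover have "N (\<lambda>t. c n * u (n + k) t) = 1" for n
    using norm_scale[OF u, of "c n" "n + k"] cp[of n] by simp
  moreover have "N (\<lambda>t. c0 * f t) = 1" using norm_scale[OF f] c0p by simp
  ultimately have "(\<lambda>n. N (\<lambda>t. c n * u (n + k) t - c0 * f t)) \<longlonglongrightarrow> 0"
    using H u f scale_mem unfolding kadets_klee_def by auto
  then have "(\<lambda>n. inverse (c n) * (N (\<lambda>t. c n * u (n + k) t - c0 * f t) + \<bar>c0 - c n\<bar> * N f))
      \<longlonglongrightarrow> inverse c0 * (0 + \<bar>c0 - c0\<bar> * N f)"
    using c c0p by (intro tendsto_intros) auto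
  then have bound: "(\<lambda>n. inverse (c n) * (N (\<lambda>t. c n * u (n + k) t - c0 * f t) + \<bar>c0 - c n\<bar> * N f)) \<longlonglongrightarrow> 0"
    by simp
  have le: "N (\<lambda>t. u (n + k) t - f t)
      \<le> inverse (c n) * (N (\<lambda>t. c n * u (n + k) t - c0 * f t) + \<bar>c0 - c n\<bar> * N f)" for n
  proof -
    have "c n * N (\<lambda>t. u (n + k) t - f t) = N (\<lambda>t. c n * (u (n + k) t - f t))"
      using norm_scale[OF diff_mem[OF u f], of "c n"] cp(1)[of n] by simp
    also have "\<dots> = N (\<lambda>t. (c n * u (n + k) t - c0 * f t) + (c0 - c n) * f t)"
      by (simp add: algebra_simps)
    also have "\<dots> \<le> N (\<lambda>t. c n * u (n + k) t - c0 * f t) + N (\<lambda>t. (c0 - c n) * f t)"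
      using u f by (intro norm_triangle diff_mem scale_mem)
    also have "N (\<lambda>t. (c0 - c n) * f t) = \<bar>c0 - c n\<bar> * N f" by (rule norm_scale[OF f])
    finally show ?thesis using cp(1)[of n] by (simp add: field_simps)
  qed
  have "(\<lambda>n. N (\<lambda>t. u (n + k) t - f t)) \<longlonglongrightarrow> 0"
    by (rule tendsto_sandwich[OF _ _ tendsto_const bound])
      (use le norm_nonneg[OF diff_mem[OF u f]] in auto)
  then show ?thesis by (rule LIMSEQ_offset)
qed

text \<open>
  Let \<open>h\<^sub>n\<close> be \<open>f\<close> with its sign flipped where \<open>\<bar>v\<^sub>n\<bar> \<ge> e \<bar>f\<bar>\<close>.  Then \<open>\<bar>h\<^sub>n\<bar> = \<bar>f\<bar>\<close> and \<open>h\<^sub>n\<close> converges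
  to \<open>f\<close>, so \<open>h\<^sub>n - f\<close> tends to zero in norm.  Since \<open>\<bar>h\<^sub>n - f\<bar> = 2 \<bar>f\<bar>\<close> on the flipped set, this
  controls \<open>v\<^sub>n\<close> there; elsewhere \<open>\<bar>v\<^sub>n\<bar> < e \<bar>f\<bar>\<close>.
\<close>

lemma kadets_klee_dominated:
  assumes H: "kadets_klee conv X N" and v: "\<And>n. v n \<in> X" and f: "f \<in> X"
    and dom: "\<And>n t. \<bar>v n t\<bar> \<le> \<bar>f t\<bar>" and conv: "conv v (\<lambda>t. 0)"
  shows "(\<lambda>n. N (v n)) \<longlonglongrightarrow> 0"
proof (rule LIMSEQ_I)
  fix r :: real assume r: "r > 0"
  \<comment> \<open>Chosen so that \<open>e * N f < r / 2\<close>, also when \<open>N f = 0\<close>.\<close>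
  define e where "e = r / (2 * (N f + 1))"
  have Nf: "0 \<le> N f" by (rule norm_nonneg[OF f])
  have e: "e > 0" using r Nf by (simp add: e_def)
  have eN: "e * N f < r / 2" using r Nf by (simp add: e_def field_simps)
  define h where "h n t = (if e * \<bar>f t\<bar> \<le> \<bar>v n t\<bar> then - f t else f t)" for n t
  have hS: "h n \<in> S" for n unfolding h_def using v f subset by (intro flip_mem) auto
  have h: "h n \<in> X" and "N (h n) \<le> N f" for n
    using solid[OF hS f] by (auto simp: h_def)
  moreover have "N f \<le> N (h n)" for n
    using solid[OF subsetD[OF subset f] h] by (auto simp: h_def)
  ultimately have Nh: "N (h n) = N f" for n by (simp add: antisym)
  have "conv h f" unfolding h_def using v f subset e conv by (intro conv_flip) auto
  then have lim: "(\<lambda>n. N (\<lambda>t. h n t - f t)) \<longlonglongrightarrow> 0"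
    by (intro kadets_klee_norm_tendsto H h f) (simp_all add: Nh)
  have le: "N (v n) \<le> e * N f + N (\<lambda>t. h n t - f t) / 2" for n
  proof -
    let ?d = "\<lambda>t. \<bar>h n t - f t\<bar>"
    have d: "?d \<in> X" "N ?d \<le> N (\<lambda>t. h n t - f t)"
      using abs_mem norm_abs_le diff_mem[OF h f] by auto
    have "N (v n) \<le> N (\<lambda>t. e * \<bar>f t\<bar> + (1/2) * ?d t)"
    proof -
      have "\<bar>v n t\<bar> \<le> \<bar>e * \<bar>f t\<bar> + (1/2) * ?d t\<bar>" for t
      proof (cases "e * \<bar>f t\<bar> \<le> \<bar>v n t\<bar>")
        case True
        then have "?d t = 2 * \<bar>f t\<bar>" by (simp add: h_def)
        moreover have "0 \<le> e * \<bar>f t\<bar>" using e by simp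
        ultimately show ?thesis using dom[of n t] by simp
      next
        case False
        then show ?thesis by (simp add: h_def)
      qed
      moreover have "(\<lambda>t. e * \<bar>f t\<bar> + (1/2) * ?d t) \<in> X"
        using abs_mem[OF f] d by (intro add_mem scale_mem)
      ultimately show ?thesis using solid[of "v n"] v subset by auto
    qed
    also have "\<dots> \<le> N (\<lambda>t. e * \<bar>f t\<bar>) + N (\<lambda>t. (1/2) * ?d t)"
      using abs_mem[OF f] d by (intro norm_triangle scale_mem)
    also have "\<dots> = e * N (\<lambda>t. \<bar>f t\<bar>) + (1/2) * N ?d"
      using norm_scale[OF abs_mem[OF f], of e] norm_scale[OF d(1), of "1/2"] e by simp
    also have "\<dots> \<le> e * N f + N (\<lambda>t. h n t - f t) / 2"
      using mult_left_mono[OF norm_abs_le[OF f], of e] d(2) e by (intro add_mono) auto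
    finally show ?thesis .
  qed
  have "eventually (\<lambda>n. N (\<lambda>t. h n t - f t) < r) sequentially"
    using order_tendstoD(2)[OF lim r] .
  then have "eventually (\<lambda>n. norm (N (v n) - 0) < r) sequentially"
  proof eventually_elim
    case (elim n)
    with le[of n] eN norm_nonneg[OF v[of n]] show ?case by simp
  qed
  then show "\<exists>no. \<forall>n\<ge>no. norm (N (v n) - 0) < r" by (simp add: eventually_sequentially)
qed

text \<open>
  The excess of \<open>\<bar>f\<bar>\<close> over \<open>\<bar>u\<^sub>n\<bar>\<close> is dominated by \<open>f\<close> and converges to zero, so its norm does as
  well, while \<open>\<bar>f\<bar>\<close> is at most \<open>\<bar>u\<^sub>n\<bar>\<close> plus this excess.
\<close>

lemma kadets_klee_norm_lower_semicontinuous: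
  assumes H: "kadets_klee conv X N" and u: "\<And>n. u n \<in> X" and f: "f \<in> X"
    and conv: "conv u f" and e: "e > 0"
  shows "eventually (\<lambda>n. N f < N (u n) + e) sequentially"
proof -
  define v where "v n t = max 0 (\<bar>f t\<bar> - \<bar>u n t\<bar>)" for n t
  have vS: "v n \<in> S" for n unfolding v_def using u f subset by (intro excess_mem) auto
  have v: "v n \<in> X" for n using solid[OF vS f] by (auto simp: v_def)
  have "(\<lambda>n. N (v n)) \<longlonglongrightarrow> 0"
  proof (rule kadets_klee_dominated[OF H v f])
    show "\<bar>v n t\<bar> \<le> \<bar>f t\<bar>" for n t by (auto simp: v_def)
    show "conv v (\<lambda>t. 0)" unfolding v_def using u f subset conv by (intro conv_excess) auto
  qed
  from order_tendstoD(2)[OF this e] show ?thesis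
  proof eventually_elim
    case (elim n)
    have "(\<lambda>t. \<bar>u n t\<bar> + v n t) \<in> X" using abs_mem[OF u] v by (rule add_mem)
    then have "N f \<le> N (\<lambda>t. \<bar>u n t\<bar> + v n t)"
      using solid[of f] subset f by (auto simp: v_def)
    also have "\<dots> \<le> N (\<lambda>t. \<bar>u n t\<bar>) + N (v n)" using abs_mem[OF u] v by (rule norm_triangle)
    also have "\<dots> \<le> N (u n) + N (v n)" using norm_abs_le[OF u] by simp
    finally show ?case using elim by simp
  qed
qed

end

sublocale banach_function_space \<subseteq>
  measure: normed_function_ideal "\<lambda>f. AE t in M. f t = 0" X N "borel_measurable M"
    "tendsto_locally_in_measure M"
proof
  show "X \<subseteq> borel_measurable M" using locally_integrable by (auto simp: locally_integrable_def)
next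
  fix u :: "nat \<Rightarrow> 'a \<Rightarrow> real" and f
  assume *: "\<And>n. u n \<in> borel_measurable M" "f \<in> borel_measurable M" "tendsto_locally_in_measure M u f"
  show "tendsto_locally_in_measure M (\<lambda>n t. max 0 (\<bar>f t\<bar> - \<bar>u n t\<bar>)) (\<lambda>t. 0)"
    by (rule tendsto_locally_in_measure_le[OF *, of 1]) auto
next
  fix f g :: "'a \<Rightarrow> real" and e :: real
  assume [measurable]: "f \<in> borel_measurable M" "g \<in> borel_measurable M"
  show "(\<lambda>t. \<bar>f t - g t\<bar>) \<in> borel_measurable M"
    "(\<lambda>t. max 0 (\<bar>f t\<bar> - \<bar>g t\<bar>)) \<in> borel_measurable M"
    "(\<lambda>t. if e * \<bar>f t\<bar> \<le> \<bar>g t\<bar> then - f t else f t) \<in> borel_measurable M"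
    by measurable
qed (auto intro: ideal_mem ideal_norm tendsto_locally_in_measure_shift
  tendsto_locally_in_measure_scale tendsto_locally_in_measure_sign_flip)

sublocale banach_sequence_space \<subseteq>
  pointwise: normed_function_ideal "\<lambda>x. \<forall>\<gamma>. x \<gamma> = 0" E p "{x. \<forall>\<gamma>. \<gamma> \<notin> \<Gamma> \<longrightarrow> x \<gamma> = 0}"
    tendsto_pointwise
proof
  fix u :: "nat \<Rightarrow> 'a \<Rightarrow> real" and f
  assume *: "tendsto_pointwise u f"
  show "tendsto_pointwise (\<lambda>n t. max 0 (\<bar>f t\<bar> - \<bar>u n t\<bar>)) (\<lambda>t. 0)"
    unfolding tendsto_pointwise_def
  proof
    fix t
    have "(\<lambda>n. max 0 (\<bar>f t\<bar> - \<bar>u n t\<bar>)) \<longlonglongrightarrow> max 0 (\<bar>f t\<bar> - \<bar>f t\<bar>)"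
      using * unfolding tendsto_pointwise_def by (intro tendsto_intros) auto
    then show "(\<lambda>n. max 0 (\<bar>f t\<bar> - \<bar>u n t\<bar>)) \<longlonglongrightarrow> 0" by simp
  qed
next
  fix v :: "nat \<Rightarrow> 'a \<Rightarrow> real" and f :: "'a \<Rightarrow> real" and e :: real
  assume v: "tendsto_pointwise v (\<lambda>t. 0)" and e: "e > 0"
  show "tendsto_pointwise (\<lambda>n t. if e * \<bar>f t\<bar> \<le> \<bar>v n t\<bar> then - f t else f t) f"
    unfolding tendsto_pointwise_def
  proof
    fix t
    show "(\<lambda>n. if e * \<bar>f t\<bar> \<le> \<bar>v n t\<bar> then - f t else f t) \<longlonglongrightarrow> f t"
    proof (cases "f t = 0")
      case False
      then have "e * \<bar>f t\<bar> > 0" using e by simp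
      moreover have "(\<lambda>n. \<bar>v n t\<bar>) \<longlonglongrightarrow> 0"
        using v by (auto simp: tendsto_pointwise_def intro: tendsto_rabs_zero)
      ultimately have "eventually (\<lambda>n. \<bar>v n t\<bar> < e * \<bar>f t\<bar>) sequentially"
        by (rule order_tendstoD(2)[rotated])
      then have "eventually (\<lambda>n. (if e * \<bar>f t\<bar> \<le> \<bar>v n t\<bar> then - f t else f t) = f t) sequentially"
        by eventually_elim auto
      then show ?thesis by (rule tendsto_eventually)
    qed simp
  qed
qed (auto simp: tendsto_pointwise_def support intro: ideal_mem ideal_norm
  LIMSEQ_ignore_initial_segment tendsto_mult)

section \<open>Disjoint sets in infinite-dimensional function spaces\<close>

definition atom :: "'a measure \<Rightarrow> 'a set \<Rightarrow> bool" where
  "atom M A \<longleftrightarrow> A \<in> sets M \<and> emeasure M A \<noteq> 0 \<and>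
     (\<forall>S\<in>sets M. S \<subseteq> A \<longrightarrow> emeasure M S = 0 \<or> emeasure M (A - S) = 0)"

text \<open>
  On an atom, each statement \<open>f t \<le> q\<close> with rational \<open>q\<close> is either almost surely true or almost
  surely false.  So almost all points of the atom agree on all these statements, and the rational
  cuts determine the value.
\<close>

lemma atom_AE_constant:
  fixes f :: "'a \<Rightarrow> real"
  assumes A: "atom M A" and f: "f \<in> borel_measurable M"
  shows "\<exists>c. AE t in M. t \<in> A \<longrightarrow> f t = c"
proof -
  note [measurable] = f
  have As[measurable]: "A \<in> sets M" and A0: "emeasure M A \<noteq> 0" using A by (auto simp: atom_def)
  define S where "S q = {t\<in>A. f t \<le> of_rat q}" for q
  have S_eq: "S q = {t\<in>space M. t \<in> A \<and> f t \<le> of_rat q}" for q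
    using sets.sets_into_space[OF As] by (auto simp: S_def)
  have S: "S q \<in> sets M" for q unfolding S_eq by measurable
  define Q where "Q q \<longleftrightarrow> emeasure M (A - S q) = 0" for q
  have "AE t in M. t \<in> A \<longrightarrow> (f t \<le> of_rat q \<longleftrightarrow> Q q)" for q
  proof (cases "Q q")
    case True
    then have "A - S q \<in> null_sets M" using S As by (auto simp: Q_def null_sets_def)
    from AE_not_in[OF this] show ?thesis
      by eventually_elim (auto simp: True S_def)
  next
    case False
    moreover have "S q \<subseteq> A" by (auto simp: S_def)
    ultimately have "emeasure M (S q) = 0" using A S unfolding Q_def atom_def by blast
    then have "S q \<in> null_sets M" using S by (auto simp: null_sets_def)
    from AE_not_in[OF this] show ?thesis
      by eventually_elim (auto simp: False S_def)
  qed
  then have ae: "AE t in M. \<forall>q. t \<in> A \<longrightarrow> (f t \<le> of_rat q \<longleftrightarrow> Q q)"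
    by (subst AE_all_countable) auto
  have "\<exists>t\<in>A. \<forall>q. f t \<le> of_rat q \<longleftrightarrow> Q q"
  proof (rule ccontr)
    assume none: "\<not> ?thesis"
    from ae have "AE t in M. t \<notin> A"
      by eventually_elim (use none in blast)
    then show False using A0 AE_iff_null_sets[OF As] by auto
  qed
  then obtain t0 where t0: "\<And>q. f t0 \<le> of_rat q \<longleftrightarrow> Q q" by blast
  have "f t = f t0" if "\<forall>q. f t \<le> of_rat q \<longleftrightarrow> Q q" for t
  proof (rule ccontr)
    have same: "f t \<le> of_rat q \<longleftrightarrow> f t0 \<le> of_rat q" for q using that t0 by blast
    assume "f t \<noteq> f t0"
    then consider "f t < f t0" | "f t0 < f t" by linarith
    then show False
    proof cases
      case 1
      then obtain q where "f t < of_rat q" "of_rat q < f t0" using of_rat_dense by blast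
      then show False using same[of q] by linarith
    next
      case 2
      then obtain q where "f t0 < of_rat q" "of_rat q < f t" using of_rat_dense by blast
      then show False using same[of q] by linarith
    qed
  qed
  then have "AE t in M. t \<in> A \<longrightarrow> f t = f t0"
    using ae by (auto elim!: eventually_mono)
  then show ?thesis by blast
qed

definition finitely_atomic :: "'a measure \<Rightarrow> 'a set \<Rightarrow> bool" where
  "finitely_atomic M A \<longleftrightarrow>
     (\<exists>\<A>. finite \<A> \<and> disjoint \<A> \<and> (\<forall>B\<in>\<A>. atom M B \<and> B \<subseteq> A) \<and> emeasure M (A - \<Union>\<A>) = 0)"

lemma finitely_atomic_Un:
  assumes "finitely_atomic M A" "finitely_atomic M B" "A \<inter> B = {}" "A \<in> sets M" "B \<in> sets M"
  shows "finitely_atomic M (A \<union> B)"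
proof -
  obtain \<A> where \<A>: "finite \<A>" "disjoint \<A>" "\<And>C. C \<in> \<A> \<Longrightarrow> atom M C \<and> C \<subseteq> A"
    "emeasure M (A - \<Union>\<A>) = 0"
    using assms(1) unfolding finitely_atomic_def by blast
  obtain \<B> where \<B>: "finite \<B>" "disjoint \<B>" "\<And>C. C \<in> \<B> \<Longrightarrow> atom M C \<and> C \<subseteq> B"
    "emeasure M (B - \<Union>\<B>) = 0"
    using assms(2) unfolding finitely_atomic_def by blast
  have "\<Union>\<A> \<in> sets M" "\<Union>\<B> \<in> sets M"
    using \<A>(1,3) \<B>(1,3) by (auto intro!: sets.finite_Union simp: atom_def)
  then have meas: "A - \<Union>\<A> \<in> sets M" "B - \<Union>\<B> \<in> sets M" using assms by auto
  have "emeasure M (A \<union> B - \<Union>(\<A> \<union> \<B>)) \<le> emeasure M ((A - \<Union>\<A>) \<union> (B - \<Union>\<B>))"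
    using meas by (intro emeasure_mono) auto
  also have "\<dots> \<le> 0" using emeasure_subadditive[OF meas] \<A>(4) \<B>(4) by simp
  finally have "emeasure M (A \<union> B - \<Union>(\<A> \<union> \<B>)) = 0" by simp
  moreover have "disjoint (\<A> \<union> \<B>)"
  proof (rule disjoint_union[OF \<A>(2) \<B>(2)])
    show "\<Union>\<A> \<inter> \<Union>\<B> = {}" using \<A>(3) \<B>(3) assms(3) by blast
  qed
  moreover have "\<forall>C\<in>\<A> \<union> \<B>. atom M C \<and> C \<subseteq> A \<union> B" using \<A>(3) \<B>(3) by blast
  ultimately show ?thesis unfolding finitely_atomic_def using \<A>(1) \<B>(1) by (intro exI[of _ "\<A> \<union> \<B>"]) auto
qed

text \<open>
  A set that is not finitely atomic is neither null nor an atom, so it splits into two parts of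
  positive measure, and one of the two parts is again not finitely atomic.
\<close>

lemma split_not_finitely_atomic:
  assumes A: "A \<in> sets M" and nA: "\<not> finitely_atomic M A"
  shows "\<exists>B\<in>sets M. B \<subseteq> A \<and> \<not> finitely_atomic M B \<and> emeasure M (A - B) \<noteq> 0"
proof -
  have "emeasure M A \<noteq> 0"
    using nA unfolding finitely_atomic_def by (auto dest!: spec[of _ "{}"])
  moreover have "\<not> atom M A"
    using nA unfolding finitely_atomic_def by (auto dest!: spec[of _ "{A}"])
  ultimately obtain S where S: "S \<in> sets M" "S \<subseteq> A" "emeasure M S \<noteq> 0" "emeasure M (A - S) \<noteq> 0"
    using A unfolding atom_def by blast
  have "\<not> finitely_atomic M S \<or> \<not> finitely_atomic M (A - S)"
    using finitely_atomic_Un[of M S "A - S"] S A nA by (auto simp: Un_absorb1)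
  moreover have "A - (A - S) = S" using S by auto
  \<comment> \<open>The second case takes \<open>A - S\<close> for \<open>B\<close>, so the discarded part is \<open>S\<close>.\<close>
  ultimately show ?thesis using S A by (metis Diff_subset sets.Diff)
qed

text \<open>Iterating the splitting gives a decreasing sequence whose successive differences are the sets.\<close>

lemma not_finitely_atomic_disjoint_family:
  assumes A: "A \<in> sets M" and nA: "\<not> finitely_atomic M A"
  obtains C :: "nat \<Rightarrow> 'a set"
  where "\<And>n. C n \<in> sets M" "\<And>n. emeasure M (C n) \<noteq> 0" "disjoint_family C"
proof -
  have "\<exists>B. \<forall>n. (B n \<in> sets M \<and> \<not> finitely_atomic M (B n)) \<and>
      (B (Suc n) \<subseteq> B n \<and> emeasure M (B n - B (Suc n)) \<noteq> 0)"
    by (rule dependent_nat_choice) (use A nA split_not_finitely_atomic in blast)+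
  then obtain B where B: "\<And>n. B n \<in> sets M" "\<And>n. B (Suc n) \<subseteq> B n"
    "\<And>n. emeasure M (B n - B (Suc n)) \<noteq> 0" by blast
  have dec: "B n \<subseteq> B m" if "m \<le> n" for m n using B(2) that by (rule lift_Suc_antimono_le)
  have "disjoint_family (\<lambda>n. B n - B (Suc n))"
    unfolding disjoint_family_on_def
  proof (intro ballI impI)
    fix m n :: nat assume "m \<noteq> n"
    then consider "Suc m \<le> n" | "Suc n \<le> m" by linarith
    then show "(B m - B (Suc m)) \<inter> (B n - B (Suc n)) = {}"
      by cases (use dec in blast)+
  qed
  with B that[of "\<lambda>n. B n - B (Suc n)"] show ?thesis by auto
qed

lemma (in sigma_finite_measure) positive_subset_of_finite_measure:
  assumes A: "A \<in> sets M" "emeasure M A \<noteq> 0"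
  shows "\<exists>D\<in>sets M. D \<subseteq> A \<and> emeasure M D \<noteq> 0 \<and> emeasure M D < \<infinity>"
proof -
  obtain W :: "nat \<Rightarrow> 'a set" where W: "range W \<subseteq> sets M" "(\<Union>i. W i) = space M"
    "\<And>i. emeasure M (W i) \<noteq> \<infinity>"
    using sigma_finite by metis
  have "\<exists>i. emeasure M (A \<inter> W i) \<noteq> 0"
  proof (rule ccontr)
    assume "\<not> ?thesis"
    then have "(\<Union>i. A \<inter> W i) \<in> null_sets M"
      using W A by (intro null_sets_UN) (auto simp: null_sets_def)
    moreover have "(\<Union>i. A \<inter> W i) = A" using W sets.sets_into_space[OF A(1)] by auto
    ultimately show False using A by auto
  qed
  then obtain i where i: "emeasure M (A \<inter> W i) \<noteq> 0" by blast
  have "emeasure M (A \<inter> W i) \<le> emeasure M (W i)" using W by (intro emeasure_mono) auto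
  also have "\<dots> < \<infinity>" using W(3)[of i] by (simp add: less_top)
  finally show ?thesis using i W A by (intro bexI[of _ "A \<inter> W i"]) auto
qed

lemma (in sigma_finite_measure) emeasure_atom_finite:
  assumes A: "atom M A"
  shows "emeasure M A < \<infinity>"
proof -
  have As: "A \<in> sets M" "emeasure M A \<noteq> 0" using A by (auto simp: atom_def)
  obtain D where D: "D \<in> sets M" "D \<subseteq> A" "emeasure M D \<noteq> 0" "emeasure M D < \<infinity>"
    using positive_subset_of_finite_measure[OF As] by blast
  then have "emeasure M (A - D) = 0" using A by (auto simp: atom_def)
  moreover have "emeasure M A \<le> emeasure M D + emeasure M (A - D)"
    using emeasure_subadditive[of D M "A - D"] D As by (simp add: Un_absorb1)
  ultimately show ?thesis using D by (simp add: order_le_less_trans)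
qed

context banach_function_space
begin

text \<open>Every \<open>f\<close> is almost everywhere constant on each atom, so the indicators of the atoms span.\<close>

lemma finite_dimensional_if_finitely_atomic:
  assumes sf: "sigma_finite_measure M" and atomic: "finitely_atomic M (space M)"
  shows "\<not> infinite_dimensional_mod_AE M X"
proof -
  obtain \<A> where \<A>: "finite \<A>" "disjoint \<A>" "\<And>A. A \<in> \<A> \<Longrightarrow> atom M A"
    "emeasure M (space M - \<Union>\<A>) = 0"
    using atomic unfolding finitely_atomic_def by blast
  define ind where "ind A = (indicator A :: 'a \<Rightarrow> real)" for A
  have supp: "{t. ind A t \<noteq> 0} = A" for A by (auto simp: ind_def indicator_def)
  have inj: "inj_on ind \<A>" using supp by (auto intro!: inj_onI) metis+
  have null: "space M - \<Union>\<A> \<in> null_sets M"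
    using \<A> by (auto simp: null_sets_def atom_def intro!: sets.finite_Union)
  \<comment> \<open>Coefficients are indexed by the functions \<open>b\<close>, so the atom is recovered as the support of \<open>b\<close>.\<close>
  have "\<exists>c. AE t in M. f t = (\<Sum>b\<in>ind ` \<A>. c b * b t)" if f: "f \<in> X" for f
  proof -
    have "\<forall>A\<in>\<A>. \<exists>c. AE t in M. t \<in> A \<longrightarrow> f t = c"
      using atom_AE_constant[OF \<A>(3)] f measure.subset by blast
    then obtain c where c: "\<And>A. A \<in> \<A> \<Longrightarrow> AE t in M. t \<in> A \<longrightarrow> f t = c A" by metis
    then have "AE t in M. \<forall>A\<in>\<A>. t \<in> A \<longrightarrow> f t = c A"
      using \<A>(1) by (intro AE_finite_allI) auto
    then have "AE t in M. f t = (\<Sum>b\<in>ind ` \<A>. c {t. b t \<noteq> 0} * b t)"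
      using AE_not_in[OF null] AE_space
    proof eventually_elim
      case (elim t)
      then obtain A where A: "A \<in> \<A>" "t \<in> A" by blast
      have "(\<Sum>b\<in>ind ` \<A>. c {t. b t \<noteq> 0} * b t) = (\<Sum>B\<in>\<A>. c B * ind B t)"
        by (simp add: sum.reindex[OF inj] supp)
      also have "\<dots> = (\<Sum>B\<in>\<A>. if B = A then c A else 0)"
        using A \<A>(2) by (intro sum.cong) (auto simp: ind_def indicator_def disjoint_def)
      also have "\<dots> = f t" using A \<A>(1) elim by simp
      finally show ?case by simp
    qed
    then show ?thesis by (intro exI[of _ "\<lambda>b. c {t. b t \<noteq> 0}"])
  qed
  moreover have "ind ` \<A> \<subseteq> X"
    using \<A>(3) sigma_finite_measure.emeasure_atom_finite[OF sf]
    by (auto simp: ind_def atom_def intro!: indicator_mem)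
  ultimately show ?thesis
    unfolding infinite_dimensional_mod_AE_def using \<A>(1) by blast
qed

text \<open>
  Take normalised indicators of disjoint sets of finite positive measure: a point lies in at most
  one of them, so they tend to zero at every point, hence in measure, whatever the sizes of the
  normalising factors.
\<close>

lemma null_sequence_of_unit_vectors:
  assumes sf: "sigma_finite_measure M" and inf: "infinite_dimensional_mod_AE M X"
  obtains g where "\<And>n::nat. g n \<in> X" "\<And>n. N (g n) = 1" "\<And>n t. 0 \<le> g n t"
    "tendsto_locally_in_measure M g (\<lambda>t. 0)"
proof -
  obtain C :: "nat \<Rightarrow> 'a set" where C: "\<And>n. C n \<in> sets M" "\<And>n. emeasure M (C n) \<noteq> 0" "disjoint_family C"
    using not_finitely_atomic_disjoint_family[OF sets.top]
      finite_dimensional_if_finitely_atomic[OF sf] inf by blast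
  have "\<forall>n. \<exists>D\<in>sets M. D \<subseteq> C n \<and> emeasure M D \<noteq> 0 \<and> emeasure M D < \<infinity>"
    using sigma_finite_measure.positive_subset_of_finite_measure[OF sf] C(1,2) by blast
  then obtain D where D: "\<And>n. D n \<in> sets M" "\<And>n. D n \<subseteq> C n" "\<And>n. emeasure M (D n) \<noteq> 0"
    "\<And>n. emeasure M (D n) < \<infinity>" by metis
  define k where "k n = N (indicator (D n))" for n
  define g where "g n t = inverse (k n) * indicator (D n) t" for n t
  have ind: "indicator (D n) \<in> X" for n using D by (intro indicator_mem) auto
  have k: "k n > 0" for n
  proof -
    have "\<not> (AE t in M. (indicator (D n) t :: real) = 0)"
      using AE_iff_null_sets[OF D(1), of n] D(3)[of n] by (auto simp: indicator_def)
    then show ?thesis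
      using norm_eq_zero_iff[OF ind, of n] norm_nonneg[OF ind, of n] by (simp add: k_def)
  qed
  have gX: "g n \<in> X" for n unfolding g_def using ind by (rule scale_mem)
  show thesis
  proof (rule that[of g, OF gX])
    show "N (g n) = 1" for n
      unfolding g_def using norm_scale[OF ind, of "inverse (k n)" n] k[of n] by (simp add: k_def)
    show "0 \<le> g n t" for n t using k[of n] by (simp add: g_def)
    show "tendsto_locally_in_measure M g (\<lambda>t. 0)"
    proof (rule tendsto_locally_in_measure_pointwise)
      fix t
      show "(\<lambda>n. g n t) \<longlonglongrightarrow> 0"
      proof (cases "\<exists>m. t \<in> D m")
        case True
        then obtain m where m: "t \<in> D m" by blast
        have "g n t = 0" if "n > m" for n
        proof -
          have "C m \<inter> C n = {}" using C(3) that unfolding disjoint_family_on_def by force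
          then show ?thesis using m D(2)[of m] D(2)[of n] by (auto simp: g_def indicator_def)
        qed
        then show ?thesis
          by (intro tendsto_eventually) (auto simp: eventually_at_top_dense)
      next
        case False
        then show ?thesis by (simp add: g_def)
      qed
    qed (use gX measure.subset in auto)
  qed
qed

end

section \<open>Convergence on a disjoint union\<close>

lemma measurable_section:
  assumes u: "u \<in> borel_measurable (disjoint_union_measure \<Gamma> M)" and \<gamma>: "\<gamma> \<in> \<Gamma>"
  shows "(\<lambda>t. u (\<gamma>, t)) \<in> borel_measurable (M \<gamma>)"
proof -
  have "Pair \<gamma> \<in> measurable (M \<gamma>) (disjoint_union_measure \<Gamma> M)"
  proof (rule measurableI)
    fix A assume A: "A \<in> sets (disjoint_union_measure \<Gamma> M)"
    then have "Pair \<gamma> -` A \<in> sets (M \<gamma>)" using \<gamma> by (simp add: sets_disjoint_union_measure)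
    then show "Pair \<gamma> -` A \<inter> space (M \<gamma>) \<in> sets (M \<gamma>)" by auto
  qed (use \<gamma> in \<open>simp add: space_disjoint_union_measure\<close>)
  from measurable_compose[OF this u] show ?thesis .
qed

text \<open>
  For the implication from the sections to the whole, a set of finite measure has sections of
  summable measure, so dominated convergence for sums over \<open>\<Gamma>\<close> applies.  For the converse, a set
  in one component is a set of the same measure in the disjoint union.
\<close>

lemma tendsto_locally_in_measure_disjoint_union_iff:
  assumes u: "\<And>n. u n \<in> borel_measurable (disjoint_union_measure \<Gamma> M)"
    and f: "f \<in> borel_measurable (disjoint_union_measure \<Gamma> M)"
  shows "tendsto_locally_in_measure (disjoint_union_measure \<Gamma> M) u f \<longleftrightarrow>
    (\<forall>\<gamma>\<in>\<Gamma>. tendsto_locally_in_measure (M \<gamma>) (\<lambda>n t. u n (\<gamma>, t)) (\<lambda>t. f (\<gamma>, t)))"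
    (is "?L \<longleftrightarrow> ?R")
proof
  let ?m = "disjoint_union_measure \<Gamma> M"
  assume L: ?L
  show ?R
    unfolding tendsto_locally_in_measure_def
  proof (intro ballI allI impI)
    fix \<gamma> F and e :: real
    assume \<gamma>: "\<gamma> \<in> \<Gamma>" and e: "e > 0" and F: "F \<in> sets (M \<gamma>)" and fin: "emeasure (M \<gamma>) F < \<infinity>"
    have sec: "Pair \<delta> -` Pair \<gamma> ` A = (if \<delta> = \<gamma> then A else {})" for \<delta> and A :: "'b set"
      by auto
    have sets: "Pair \<gamma> ` A \<in> sets ?m" if "A \<in> sets (M \<gamma>)" for A
      using that sets.sets_into_space[OF that] \<gamma> by (auto simp: sets_disjoint_union_measure sec)
    have em: "emeasure ?m (Pair \<gamma> ` A) = emeasure (M \<gamma>) A" if "A \<in> sets (M \<gamma>)" for A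
    proof -
      have "emeasure ?m (Pair \<gamma> ` A)
          = (\<integral>\<^sup>+\<delta>. emeasure (M \<gamma>) A * indicator {\<gamma>} \<delta> \<partial>count_space \<Gamma>)"
        unfolding emeasure_disjoint_union_measure[OF sets[OF that]]
        by (intro nn_integral_cong) (auto simp: sec)
      also have "\<dots> = emeasure (M \<gamma>) A"
        using \<gamma> by (subst nn_integral_cmult_indicator) auto
      finally show ?thesis .
    qed
    have "(\<lambda>n. emeasure ?m {z \<in> Pair \<gamma> ` F. e \<le> \<bar>f z - u n z\<bar>}) \<longlonglongrightarrow> 0"
      by (rule tendsto_locally_in_measureD[OF L e]) (use sets em F fin in auto)
    moreover have "{z \<in> Pair \<gamma> ` F. e \<le> \<bar>f z - u n z\<bar>}
        = Pair \<gamma> ` {t \<in> F. e \<le> \<bar>f (\<gamma>, t) - u n (\<gamma>, t)\<bar>}" for n by auto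
    moreover have "{t \<in> F. e \<le> \<bar>f (\<gamma>, t) - u n (\<gamma>, t)\<bar>} \<in> sets (M \<gamma>)" for n
      using measurable_section[OF u \<gamma>] measurable_section[OF f \<gamma>] F
      by (rule measurable_deviation_set)
    ultimately show "(\<lambda>n. emeasure (M \<gamma>) {t \<in> F. e \<le> \<bar>f (\<gamma>, t) - u n (\<gamma>, t)\<bar>}) \<longlonglongrightarrow> 0"
      by (simp add: em)
  qed
next
  let ?m = "disjoint_union_measure \<Gamma> M"
  assume R: ?R
  show ?L
    unfolding tendsto_locally_in_measure_def
  proof (intro ballI allI impI)
    fix F and e :: real
    assume e: "e > 0" and F: "F \<in> sets ?m" and fin: "emeasure ?m F < \<infinity>"
    let ?S = "\<lambda>n. {z \<in> F. e \<le> \<bar>f z - u n z\<bar>}"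
    have S: "?S n \<in> sets ?m" for n using u f F by (rule measurable_deviation_set)
    have F\<gamma>: "Pair \<gamma> -` F \<in> sets (M \<gamma>)" if "\<gamma> \<in> \<Gamma>" for \<gamma>
      using F that by (simp add: sets_disjoint_union_measure)
    have total: "(\<integral>\<^sup>+\<gamma>. emeasure (M \<gamma>) (Pair \<gamma> -` F) \<partial>count_space \<Gamma>) < \<infinity>"
      using fin by (simp add: emeasure_disjoint_union_measure[OF F])
    have "(\<lambda>n. \<integral>\<^sup>+\<gamma>. emeasure (M \<gamma>) (Pair \<gamma> -` ?S n) \<partial>count_space \<Gamma>)
        \<longlonglongrightarrow> (\<integral>\<^sup>+\<gamma>. 0 \<partial>count_space \<Gamma>)"
    proof (rule nn_integral_dominated_convergence[OF _ _ _ _ total])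
      show "AE \<gamma> in count_space \<Gamma>. emeasure (M \<gamma>) (Pair \<gamma> -` ?S n) \<le> emeasure (M \<gamma>) (Pair \<gamma> -` F)" for n
        using F\<gamma> by (auto simp: AE_count_space intro!: emeasure_mono)
      show "AE \<gamma> in count_space \<Gamma>. (\<lambda>n. emeasure (M \<gamma>) (Pair \<gamma> -` ?S n)) \<longlonglongrightarrow> 0"
        unfolding AE_count_space
      proof
        fix \<gamma> assume \<gamma>: "\<gamma> \<in> \<Gamma>"
        have "emeasure (M \<gamma>) (Pair \<gamma> -` F) \<le> (\<integral>\<^sup>+\<gamma>. emeasure (M \<gamma>) (Pair \<gamma> -` F) \<partial>count_space \<Gamma>)"
          using \<gamma> by (rule nn_integral_ge_point)
        with total have "emeasure (M \<gamma>) (Pair \<gamma> -` F) < \<infinity>" by (rule order_le_less_trans[rotated])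
        from tendsto_locally_in_measureD[OF R[rule_format, OF \<gamma>] e F\<gamma>[OF \<gamma>] this]
        show "(\<lambda>n. emeasure (M \<gamma>) (Pair \<gamma> -` ?S n)) \<longlonglongrightarrow> 0" by (simp add: vimage_def)
      qed
    qed auto
    then show "(\<lambda>n. emeasure ?m (?S n)) \<longlonglongrightarrow> 0"
      by (simp add: emeasure_disjoint_union_measure[OF S])
  qed
qed

section \<open>Direct sums\<close>

lemma (in banach_sequence_space) norm_abs:
  assumes x: "x \<in> E"
  shows "p (\<lambda>\<gamma>. \<bar>x \<gamma>\<bar>) = p x"
  using pointwise.norm_abs_le[OF x] ideal_norm[of x "\<lambda>\<gamma>. \<bar>x \<gamma>\<bar>"] pointwise.abs_mem[OF x] support[OF x]
  by (intro antisym) auto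

locale direct_sum_of_function_spaces = sequence: banach_sequence_space \<Gamma> E p
  for \<Gamma> :: "'i set" and E p +
  fixes M :: "'i \<Rightarrow> 'a measure"
    and X :: "'i \<Rightarrow> ('a \<Rightarrow> real) set"
    and N :: "'i \<Rightarrow> ('a \<Rightarrow> real) \<Rightarrow> real"
  assumes component: "\<gamma> \<in> \<Gamma> \<Longrightarrow> banach_function_space (M \<gamma>) (X \<gamma>) (N \<gamma>)"
begin

lemma component_norm_nonneg: "\<gamma> \<in> \<Gamma> \<Longrightarrow> f \<in> X \<gamma> \<Longrightarrow> 0 \<le> N \<gamma> f"
  by (rule banach_space_of_functions.norm_nonneg[OF banach_function_space.axioms(1)[OF component]])

lemma section_mem: "x \<in> direct_sum \<Gamma> X N E \<Longrightarrow> \<gamma> \<in> \<Gamma> \<Longrightarrow> (\<lambda>t. x (\<gamma>, t)) \<in> X \<gamma>"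
  by (simp add: direct_sum_def)

lemma sum_norms_mem: "x \<in> direct_sum \<Gamma> X N E \<Longrightarrow> sum_norms \<Gamma> N x \<in> E"
  by (simp add: direct_sum_def)

lemma sum_norms_nonneg: "x \<in> direct_sum \<Gamma> X N E \<Longrightarrow> 0 \<le> sum_norms \<Gamma> N x \<gamma>"
  by (simp add: sum_norms_def section_mem component_norm_nonneg)

lemma sum_norms_dominated:
  assumes x: "\<And>\<gamma>. \<gamma> \<in> \<Gamma> \<Longrightarrow> (\<lambda>t. x (\<gamma>, t)) \<in> X \<gamma>"
    and a: "a \<in> E" and le: "\<And>\<gamma>. \<gamma> \<in> \<Gamma> \<Longrightarrow> N \<gamma> (\<lambda>t. x (\<gamma>, t)) \<le> a \<gamma>"
  shows "x \<in> direct_sum \<Gamma> X N E" "direct_sum_norm \<Gamma> N p x \<le> p a"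
proof -
  have bound: "\<bar>sum_norms \<Gamma> N x \<gamma>\<bar> \<le> \<bar>a \<gamma>\<bar>" if "\<gamma> \<in> \<Gamma>" for \<gamma>
    using component_norm_nonneg[OF that x[OF that]] le[OF that] that by (simp add: sum_norms_def)
  have zero: "sum_norms \<Gamma> N x \<gamma> = 0" if "\<gamma> \<notin> \<Gamma>" for \<gamma> using that by (simp add: sum_norms_def)
  show "x \<in> direct_sum \<Gamma> X N E"
    using x sequence.ideal_mem[OF zero a bound] by (simp add: direct_sum_def)
  show "direct_sum_norm \<Gamma> N p x \<le> p a"
    using sequence.ideal_norm[OF zero a bound] by (simp add: direct_sum_norm_def)
qed

lemma direct_sum_measurable:
  "x \<in> direct_sum \<Gamma> X N E \<Longrightarrow> x \<in> borel_measurable (disjoint_union_measure \<Gamma> M)"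
  by (rule subsetD[OF direct_sum_subset_borel_measurable[OF component]])

lemma direct_sum_tendsto_iff:
  assumes "\<And>n. u n \<in> direct_sum \<Gamma> X N E" "f \<in> direct_sum \<Gamma> X N E"
  shows "tendsto_locally_in_measure (disjoint_union_measure \<Gamma> M) u f \<longleftrightarrow>
    (\<forall>\<gamma>\<in>\<Gamma>. tendsto_locally_in_measure (M \<gamma>) (\<lambda>n t. u n (\<gamma>, t)) (\<lambda>t. f (\<gamma>, t)))"
  using assms by (intro tendsto_locally_in_measure_disjoint_union_iff direct_sum_measurable)

subsection \<open>Necessity\<close>

text \<open>The component \<open>\<gamma>0\<close> is embedded isometrically by placing \<open>c g\<close> at \<open>\<gamma>0\<close>, with \<open>c = 1 / \<parallel>e\<^bsub>\<gamma>0\<^esub>\<parallel>\<close>.\<close>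

lemma H_measure_component:
  assumes H: "H_measure (disjoint_union_measure \<Gamma> M) (direct_sum \<Gamma> X N E) (direct_sum_norm \<Gamma> N p)"
    and \<gamma>0: "\<gamma>0 \<in> \<Gamma>"
  shows "H_measure (M \<gamma>0) (X \<gamma>0) (N \<gamma>0)"
  unfolding kadets_klee_def
proof (intro allI impI, elim conjE)
  fix u f
  assume u: "\<forall>n. u n \<in> X \<gamma>0 \<and> N \<gamma>0 (u n) = 1" and f: "f \<in> X \<gamma>0" "N \<gamma>0 f = 1"
    and conv: "tendsto_locally_in_measure (M \<gamma>0) u f"
  interpret S: banach_function_space "M \<gamma>0" "X \<gamma>0" "N \<gamma>0" using \<gamma>0 by (rule component)
  define e where "e = (indicator {\<gamma>0} :: 'i \<Rightarrow> real)"
  have e: "e \<in> E" unfolding e_def using \<gamma>0 by (intro sequence.indicator_mem) auto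
  have "e \<gamma>0 \<noteq> 0" by (simp add: e_def)
  then have "p e \<noteq> 0" using sequence.norm_eq_zero_iff[OF e] by blast
  then have pe: "p e > 0" using sequence.norm_nonneg[OF e] by simp
  define c where "c = inverse (p e)"
  have c: "c > 0" "c * p e = 1" using pe by (auto simp: c_def)
  define emb where "emb g = (\<lambda>(\<gamma>, t). if \<gamma> = \<gamma>0 then c * g t else 0)" for g :: "'a \<Rightarrow> real"
  have sum_emb: "sum_norms \<Gamma> N (emb g) = (\<lambda>\<gamma>. (c * N \<gamma>0 g) * e \<gamma>)" if "g \<in> X \<gamma>0" for g
  proof
    fix \<gamma>
    have "N \<gamma> (\<lambda>t. 0) = 0" if "\<gamma> \<in> \<Gamma>"
      by (rule banach_space_of_functions.norm_zero[OF banach_function_space.axioms(1)[OF component[OF that]]])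
    then show "sum_norms \<Gamma> N (emb g) \<gamma> = (c * N \<gamma>0 g) * e \<gamma>"
      using S.norm_scale[OF that, of c] c \<gamma>0
      by (cases "\<gamma> = \<gamma>0") (auto simp: sum_norms_def emb_def e_def)
  qed
  have emb_mem: "emb g \<in> direct_sum \<Gamma> X N E" if "g \<in> X \<gamma>0" for g
  proof -
    have "(\<lambda>t. emb g (\<gamma>, t)) \<in> X \<gamma>" if "\<gamma> \<in> \<Gamma>" for \<gamma>
      using banach_space_of_functions.zero_mem[OF banach_function_space.axioms(1)[OF component[OF that]]]
        S.scale_mem[OF \<open>g \<in> X \<gamma>0\<close>, of c]
      by (cases "\<gamma> = \<gamma>0") (auto simp: emb_def)
    moreover have "sum_norms \<Gamma> N (emb g) \<in> E"
      unfolding sum_emb[OF that] using e by (rule sequence.scale_mem)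
    ultimately show ?thesis by (simp add: direct_sum_def)
  qed
  have norm_emb: "direct_sum_norm \<Gamma> N p (emb g) = N \<gamma>0 g" if "g \<in> X \<gamma>0" for g
  proof -
    have "direct_sum_norm \<Gamma> N p (emb g) = \<bar>c * N \<gamma>0 g\<bar> * p e"
      unfolding direct_sum_norm_def sum_emb[OF that] using e by (rule sequence.norm_scale)
    also have "\<dots> = N \<gamma>0 g" using c S.norm_nonneg[OF that] by (simp add: mult.commute mult.left_commute)
    finally show ?thesis .
  qed
  have "tendsto_locally_in_measure (disjoint_union_measure \<Gamma> M) (\<lambda>n. emb (u n)) (emb f)"
    unfolding direct_sum_tendsto_iff[OF emb_mem emb_mem, OF u[rule_format, THEN conjunct1] f(1)]
  proof
    fix \<gamma> assume "\<gamma> \<in> \<Gamma>"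
    show "tendsto_locally_in_measure (M \<gamma>) (\<lambda>n t. emb (u n) (\<gamma>, t)) (\<lambda>t. emb f (\<gamma>, t))"
    proof (cases "\<gamma> = \<gamma>0")
      case True
      have "tendsto_locally_in_measure (M \<gamma>0) (\<lambda>n t. c * u n t) (\<lambda>t. c * f t)"
        using u f S.measure.subset conv by (intro tendsto_locally_in_measure_scale tendsto_const) auto
      then show ?thesis using True by (simp add: emb_def)
    next
      case False
      then show ?thesis
        by (simp add: emb_def) (rule tendsto_locally_in_measure_pointwise, auto)
    qed
  qed
  then have "(\<lambda>n. direct_sum_norm \<Gamma> N p (\<lambda>z. emb (u n) z - emb f z)) \<longlonglongrightarrow> 0"
    using H u f emb_mem norm_emb unfolding kadets_klee_def by simp
  moreover have "(\<lambda>z. emb (u n) z - emb f z) = emb (\<lambda>t. u n t - f t)" for n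
    by (auto simp: emb_def fun_eq_iff algebra_simps)
  ultimately show "(\<lambda>n. N \<gamma>0 (\<lambda>t. u n t - f t)) \<longlonglongrightarrow> 0"
    using u f by (simp add: norm_emb S.diff_mem)
qed

text \<open>The index space is embedded isometrically by sending \<open>y\<close> to the family \<open>y(\<gamma>) \<phi>\<^sub>\<gamma>\<close>.\<close>

lemma H_pointwise_index:
  assumes H: "H_measure (disjoint_union_measure \<Gamma> M) (direct_sum \<Gamma> X N E) (direct_sum_norm \<Gamma> N p)"
    and unit: "\<And>\<gamma>. \<gamma> \<in> \<Gamma> \<Longrightarrow> \<phi> \<gamma> \<in> X \<gamma> \<and> N \<gamma> (\<phi> \<gamma>) = 1"
  shows "H_pointwise E p"
  unfolding kadets_klee_def
proof (intro allI impI, elim conjE)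
  fix u x
  assume u: "\<forall>n. u n \<in> E \<and> p (u n) = 1" and x: "x \<in> E" "p x = 1" and conv: "tendsto_pointwise u x"
  define emb where "emb y = (\<lambda>(\<gamma>, t). y \<gamma> * \<phi> \<gamma> t)" for y
  have emb_sec: "(\<lambda>t. emb y (\<gamma>, t)) \<in> X \<gamma>" and norm_sec: "N \<gamma> (\<lambda>t. emb y (\<gamma>, t)) = \<bar>y \<gamma>\<bar>"
    if "\<gamma> \<in> \<Gamma>" for y \<gamma>
  proof -
    interpret S: banach_function_space "M \<gamma>" "X \<gamma>" "N \<gamma>" using that by (rule component)
    show "(\<lambda>t. emb y (\<gamma>, t)) \<in> X \<gamma>" "N \<gamma> (\<lambda>t. emb y (\<gamma>, t)) = \<bar>y \<gamma>\<bar>"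
      using S.scale_mem S.norm_scale unit[OF that] by (auto simp: emb_def)
  qed
  have sum_emb: "sum_norms \<Gamma> N (emb y) = (\<lambda>\<gamma>. \<bar>y \<gamma>\<bar>)" if "y \<in> E" for y
    using norm_sec sequence.support[OF that] by (auto simp: sum_norms_def)
  have emb_mem: "emb y \<in> direct_sum \<Gamma> X N E" if "y \<in> E" for y
    using emb_sec sequence.pointwise.abs_mem[OF that] by (simp add: direct_sum_def sum_emb[OF that])
  have norm_emb: "direct_sum_norm \<Gamma> N p (emb y) = p y" if "y \<in> E" for y
    by (simp add: direct_sum_norm_def sum_emb[OF that] sequence.norm_abs[OF that])
  have "tendsto_locally_in_measure (disjoint_union_measure \<Gamma> M) (\<lambda>n. emb (u n)) (emb x)"
    unfolding direct_sum_tendsto_iff[OF emb_mem emb_mem, OF u[rule_format, THEN conjunct1] x(1)]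
  proof
    fix \<gamma> assume \<gamma>: "\<gamma> \<in> \<Gamma>"
    interpret S: banach_function_space "M \<gamma>" "X \<gamma>" "N \<gamma>" using \<gamma> by (rule component)
    have "(\<lambda>n. u n \<gamma> * \<phi> \<gamma> t) \<longlonglongrightarrow> x \<gamma> * \<phi> \<gamma> t" for t
      using conv by (intro tendsto_mult tendsto_const) (auto simp: tendsto_pointwise_def)
    then show "tendsto_locally_in_measure (M \<gamma>) (\<lambda>n t. emb (u n) (\<gamma>, t)) (\<lambda>t. emb x (\<gamma>, t))"
      using emb_sec[OF \<gamma>] S.measure.subset
      by (intro tendsto_locally_in_measure_pointwise) (auto simp: emb_def)
  qed
  then have "(\<lambda>n. direct_sum_norm \<Gamma> N p (\<lambda>z. emb (u n) z - emb x z)) \<longlonglongrightarrow> 0"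
    using H u x emb_mem norm_emb unfolding kadets_klee_def by simp
  moreover have "(\<lambda>z. emb (u n) z - emb x z) = emb (\<lambda>\<gamma>. u n \<gamma> - x \<gamma>)" for n
    by (auto simp: emb_def fun_eq_iff algebra_simps)
  ultimately show "(\<lambda>n. p (\<lambda>\<gamma>. u n \<gamma> - x \<gamma>)) \<longlonglongrightarrow> 0"
    using u x by (simp add: norm_emb sequence.diff_mem)
qed

text \<open>
  Suppose \<open>0 \<le> y \<le> x\<close>, \<open>y(\<gamma>0) < x(\<gamma>0)\<close> and \<open>\<parallel>y\<parallel> = \<parallel>x\<parallel> = 1\<close>.  The vector \<open>h\<close> has component norms
  \<open>x\<close>, lowered to \<open>y(\<gamma>0)\<close> at \<open>\<gamma>0\<close>.  Adding \<open>d g\<^sub>n\<close> with \<open>d = x(\<gamma>0) - y(\<gamma>0)\<close> in the component \<open>\<gamma>0\<close>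
  keeps the component norms between \<open>y\<close> and \<open>x\<close>: above by the triangle inequality, below because
  everything is positive.  So the sum has norm 1, and it converges in measure to \<open>h\<close>, but its
  distance to \<open>h\<close> is the positive constant \<open>d \<parallel>e\<^bsub>\<gamma>0\<^esub>\<parallel>\<close>.
\<close>

lemma strictly_monotone_index:
  assumes H: "H_measure (disjoint_union_measure \<Gamma> M) (direct_sum \<Gamma> X N E) (direct_sum_norm \<Gamma> N p)"
    and g: "\<And>\<gamma> n. \<gamma> \<in> \<Gamma> \<Longrightarrow> g \<gamma> n \<in> X \<gamma> \<and> N \<gamma> (g \<gamma> n) = 1 \<and> (\<forall>t. 0 \<le> g \<gamma> n t)"
    and null: "\<And>\<gamma>. \<gamma> \<in> \<Gamma> \<Longrightarrow> tendsto_locally_in_measure (M \<gamma>) (g \<gamma>) (\<lambda>t. 0)"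
  shows "strictly_monotone E p"
proof -
  have unit: False
    if x: "x \<in> E" "p x = 1" and y: "y \<in> E" "p y = 1"
      and le: "\<And>\<gamma>. 0 \<le> y \<gamma> \<and> y \<gamma> \<le> x \<gamma>" and less: "y \<gamma>0 < x \<gamma>0" for x y \<gamma>0
  proof -
    have \<gamma>0: "\<gamma>0 \<in> \<Gamma>" using less sequence.support[OF x(1), of \<gamma>0] sequence.support[OF y(1), of \<gamma>0] by force
    define h where "h = (\<lambda>(\<gamma>, t). (if \<gamma> = \<gamma>0 then y \<gamma> else x \<gamma>) * g \<gamma> 0 t)"
    define d where "d = x \<gamma>0 - y \<gamma>0"
    have d: "d > 0" using less by (simp add: d_def)
    define k where "k n = (\<lambda>(\<gamma>, t). (if \<gamma> = \<gamma>0 then d else 0) * g \<gamma> n t)" for n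
    define u where "u n = (\<lambda>z. h z + k n z)" for n
    have sec: "(\<lambda>t. h (\<gamma>, t)) \<in> X \<gamma>" "(\<lambda>t. u n (\<gamma>, t)) \<in> X \<gamma>" "(\<lambda>t. k n (\<gamma>, t)) \<in> X \<gamma>"
      "N \<gamma> (\<lambda>t. h (\<gamma>, t)) = (if \<gamma> = \<gamma>0 then y \<gamma> else x \<gamma>)"
      "N \<gamma> (\<lambda>t. k n (\<gamma>, t)) = (if \<gamma> = \<gamma>0 then d else 0)"
      "y \<gamma> \<le> N \<gamma> (\<lambda>t. u n (\<gamma>, t))" "N \<gamma> (\<lambda>t. u n (\<gamma>, t)) \<le> x \<gamma>"
      if \<gamma>: "\<gamma> \<in> \<Gamma>" for \<gamma> n
    proof -
      interpret S: banach_function_space "M \<gamma>" "X \<gamma>" "N \<gamma>" using \<gamma> by (rule component)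
      have gX: "g \<gamma> n \<in> X \<gamma>" "N \<gamma> (g \<gamma> n) = 1" "0 \<le> g \<gamma> n t" for n t using g[OF \<gamma>] by auto
      show hX: "(\<lambda>t. h (\<gamma>, t)) \<in> X \<gamma>" and kX: "(\<lambda>t. k n (\<gamma>, t)) \<in> X \<gamma>"
        using S.scale_mem[OF gX(1)] S.zero_mem by (auto simp: h_def k_def)
      show uX: "(\<lambda>t. u n (\<gamma>, t)) \<in> X \<gamma>" unfolding u_def using hX kX by (rule S.add_mem)
      show Nh: "N \<gamma> (\<lambda>t. h (\<gamma>, t)) = (if \<gamma> = \<gamma>0 then y \<gamma> else x \<gamma>)"
        using le[of \<gamma>] S.norm_scale[OF gX(1)] gX(2) by (auto simp: h_def)
      show Nk: "N \<gamma> (\<lambda>t. k n (\<gamma>, t)) = (if \<gamma> = \<gamma>0 then d else 0)"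
        using d S.norm_scale[OF gX(1)] gX(2) S.norm_zero by (auto simp: k_def)
      have "N \<gamma> (\<lambda>t. u n (\<gamma>, t)) \<le> N \<gamma> (\<lambda>t. h (\<gamma>, t)) + N \<gamma> (\<lambda>t. k n (\<gamma>, t))"
        unfolding u_def using hX kX by (rule S.norm_triangle)
      also have "\<dots> \<le> x \<gamma>" unfolding Nh Nk by (simp add: d_def)
      finally show "N \<gamma> (\<lambda>t. u n (\<gamma>, t)) \<le> x \<gamma>" .
      have "y \<gamma> \<le> N \<gamma> (\<lambda>t. h (\<gamma>, t))" unfolding Nh using le[of \<gamma>] by simp
      also have "\<dots> \<le> N \<gamma> (\<lambda>t. u n (\<gamma>, t))"
      proof -
        have "0 \<le> h (\<gamma>, t)" "0 \<le> k n (\<gamma>, t)" for t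
          using le[of \<gamma>] d gX(3) by (auto simp: h_def k_def)
        then have "\<bar>h (\<gamma>, t)\<bar> \<le> \<bar>u n (\<gamma>, t)\<bar>" for t by (simp add: u_def)
        then show ?thesis using S.measure.solid[OF subsetD[OF S.measure.subset hX] uX] by blast
      qed
      finally show "y \<gamma> \<le> N \<gamma> (\<lambda>t. u n (\<gamma>, t))" .
    qed
    have squeeze: "w \<in> direct_sum \<Gamma> X N E \<and> direct_sum_norm \<Gamma> N p w = 1"
      if w: "\<And>\<gamma>. \<gamma> \<in> \<Gamma> \<Longrightarrow> (\<lambda>t. w (\<gamma>, t)) \<in> X \<gamma>"
        "\<And>\<gamma>. \<gamma> \<in> \<Gamma> \<Longrightarrow> y \<gamma> \<le> N \<gamma> (\<lambda>t. w (\<gamma>, t))" "\<And>\<gamma>. \<gamma> \<in> \<Gamma> \<Longrightarrow> N \<gamma> (\<lambda>t. w (\<gamma>, t)) \<le> x \<gamma>" for w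
    proof -
      have wD: "w \<in> direct_sum \<Gamma> X N E" and "direct_sum_norm \<Gamma> N p w \<le> 1"
        using sum_norms_dominated[OF w(1) x(1) w(3)] x(2) by auto
      moreover have "p y \<le> p (sum_norms \<Gamma> N w)"
      proof (rule sequence.ideal_norm[OF sequence.support[OF y(1)] sum_norms_mem[OF wD]])
        show "\<bar>y \<gamma>\<bar> \<le> \<bar>sum_norms \<Gamma> N w \<gamma>\<bar>" if "\<gamma> \<in> \<Gamma>" for \<gamma>
          using le[of \<gamma>] w(2)[OF that] that by (simp add: sum_norms_def)
      qed
      ultimately show ?thesis using y(2) by (simp add: direct_sum_norm_def)
    qed
    have hD: "h \<in> direct_sum \<Gamma> X N E \<and> direct_sum_norm \<Gamma> N p h = 1"
      using sec le by (intro squeeze) auto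
    have uD: "u n \<in> direct_sum \<Gamma> X N E \<and> direct_sum_norm \<Gamma> N p (u n) = 1" for n
      using sec by (intro squeeze) auto
    have "tendsto_locally_in_measure (disjoint_union_measure \<Gamma> M) u h"
      unfolding direct_sum_tendsto_iff[OF uD[THEN conjunct1] hD[THEN conjunct1]]
    proof
      fix \<gamma> assume \<gamma>: "\<gamma> \<in> \<Gamma>"
      interpret S: banach_function_space "M \<gamma>" "X \<gamma>" "N \<gamma>" using \<gamma> by (rule component)
      have gm: "g \<gamma> n \<in> borel_measurable (M \<gamma>)" and hm: "(\<lambda>t. h (\<gamma>, t)) \<in> borel_measurable (M \<gamma>)"
        and um: "(\<lambda>t. u n (\<gamma>, t)) \<in> borel_measurable (M \<gamma>)" for n
        using g[OF \<gamma>] sec[OF \<gamma>] S.measure.subset by auto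
      show "tendsto_locally_in_measure (M \<gamma>) (\<lambda>n t. u n (\<gamma>, t)) (\<lambda>t. h (\<gamma>, t))"
      proof (rule tendsto_locally_in_measure_le[OF gm _ null[OF \<gamma>] d])
        show "\<bar>h (\<gamma>, t) - u n (\<gamma>, t)\<bar> \<le> d * \<bar>0 - g \<gamma> n t\<bar>" for n t
          using d by (simp add: u_def k_def abs_mult)
      qed simp
    qed
    then have "(\<lambda>n. direct_sum_norm \<Gamma> N p (\<lambda>z. u n z - h z)) \<longlonglongrightarrow> 0"
      using H uD hD unfolding kadets_klee_def by simp
    moreover have "direct_sum_norm \<Gamma> N p (\<lambda>z. u n z - h z) = d * p (indicator {\<gamma>0})" for n
    proof -
      have "sum_norms \<Gamma> N (\<lambda>z. u n z - h z) = (\<lambda>\<gamma>. d * indicator {\<gamma>0} \<gamma>)"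
        using sec(5) \<gamma>0 by (auto simp: u_def sum_norms_def fun_eq_iff)
      then show ?thesis
        using sequence.norm_scale[of "indicator {\<gamma>0}" d] sequence.indicator_mem[of "{\<gamma>0}"] \<gamma>0 d
        by (simp add: direct_sum_norm_def)
    qed
    ultimately have "d * p (indicator {\<gamma>0}) = 0" by (simp add: LIMSEQ_const_iff)
    then have "\<forall>\<gamma>. (indicator {\<gamma>0} \<gamma> :: real) = 0"
      using d sequence.norm_eq_zero_iff[of "indicator {\<gamma>0}"] sequence.indicator_mem[of "{\<gamma>0}"] \<gamma>0
      by simp
    then show False by (auto dest: spec[of _ \<gamma>0])
  qed
  show ?thesis
    unfolding strictly_monotone_def
  proof (intro ballI impI, elim conjE)
    fix x y assume x: "x \<in> E" and y: "y \<in> E" and le: "\<forall>\<gamma>. 0 \<le> y \<gamma> \<and> y \<gamma> \<le> x \<gamma>" and "y \<noteq> x"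
    then obtain \<gamma>0 where "y \<gamma>0 \<noteq> x \<gamma>0" by auto
    with le have less: "y \<gamma>0 < x \<gamma>0" by (simp add: less_le)
    with le have "x \<gamma>0 \<noteq> 0" by (metis less_le_not_le)
    then have "p x \<noteq> 0" using sequence.norm_eq_zero_iff[OF x] by blast
    then have px: "p x > 0" using sequence.norm_nonneg[OF x] by simp
    show "p y < p x"
    proof (rule ccontr)
      assume "\<not> p y < p x"
      moreover have "p y \<le> p x"
        using sequence.support[OF y] x le by (intro sequence.ideal_norm) (auto intro: order_trans)
      ultimately have pxy: "p y = p x" by simp
      let ?c = "inverse (p x)"
      show False
      proof (rule unit)
        show "(\<lambda>\<gamma>. ?c * x \<gamma>) \<in> E" "(\<lambda>\<gamma>. ?c * y \<gamma>) \<in> E"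
          using x y by (auto intro: sequence.scale_mem)
        show "p (\<lambda>\<gamma>. ?c * x \<gamma>) = 1" "p (\<lambda>\<gamma>. ?c * y \<gamma>) = 1"
          using px pxy sequence.norm_scale[OF x, of ?c] sequence.norm_scale[OF y, of ?c] by auto
        show "0 \<le> ?c * y \<gamma> \<and> ?c * y \<gamma> \<le> ?c * x \<gamma>" for \<gamma>
          using le px by (auto intro: mult_left_mono)
        show "?c * y \<gamma>0 < ?c * x \<gamma>0" using less px by simp
      qed
    qed
  qed
qed

subsection \<open>Sufficiency\<close>

text \<open>
  The key step of sufficiency.  Component norms cannot drop in the limit by lower semicontinuity,
  and they cannot jump up in a coordinate because strict monotonicity leaves no room on the sphere.
\<close>

lemma component_norms_tendsto:
  assumes HX: "\<And>\<gamma>. \<gamma> \<in> \<Gamma> \<Longrightarrow> H_measure (M \<gamma>) (X \<gamma>) (N \<gamma>)"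
    and HE: "H_pointwise E p" and SM: "strictly_monotone E p"
    and u: "\<And>n. u n \<in> direct_sum \<Gamma> X N E" "\<And>n. direct_sum_norm \<Gamma> N p (u n) = 1"
    and f: "f \<in> direct_sum \<Gamma> X N E" "direct_sum_norm \<Gamma> N p f = 1"
    and conv: "tendsto_locally_in_measure (disjoint_union_measure \<Gamma> M) u f"
  shows "tendsto_pointwise (\<lambda>n. sum_norms \<Gamma> N (u n)) (sum_norms \<Gamma> N f)"
proof -
  define a where "a n = sum_norms \<Gamma> N (u n)" for n
  define b where "b = sum_norms \<Gamma> N f"
  have a: "a n \<in> E" "p (a n) = 1" "0 \<le> a n \<gamma>" for n \<gamma>
    using u sum_norms_mem sum_norms_nonneg by (auto simp: a_def direct_sum_norm_def)
  have b: "b \<in> E" "p b = 1" "0 \<le> b \<gamma>" for \<gamma>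
    using f sum_norms_mem sum_norms_nonneg by (auto simp: b_def direct_sum_norm_def)
  have a0: "a n \<gamma> = 0" and b0: "b \<gamma> = 0" if "\<gamma> \<notin> \<Gamma>" for n \<gamma>
    using that by (auto simp: a_def b_def sum_norms_def)
  have lower: "eventually (\<lambda>n. b \<gamma> < a n \<gamma> + e) sequentially" if e: "e > 0" for \<gamma> e
  proof (cases "\<gamma> \<in> \<Gamma>")
    case True
    interpret S: banach_function_space "M \<gamma>" "X \<gamma>" "N \<gamma>" using True by (rule component)
    have "tendsto_locally_in_measure (M \<gamma>) (\<lambda>n t. u n (\<gamma>, t)) (\<lambda>t. f (\<gamma>, t))"
      using conv direct_sum_tendsto_iff[of u f, OF u(1) f(1)] True by blast
    from S.measure.kadets_klee_norm_lower_semicontinuous[OF HX[OF True] _ _ this e]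
    show ?thesis using True u f section_mem by (simp add: a_def b_def sum_norms_def)
  next
    case False
    then show ?thesis using a0 b0 e by simp
  qed
  have upper: "eventually (\<lambda>n. a n \<gamma>0 < b \<gamma>0 + e) sequentially" if e: "e > 0" for \<gamma>0 e
  proof (rule ccontr)
    assume "\<not> ?thesis"
    then obtain r :: "nat \<Rightarrow> nat" where r: "strict_mono r" "\<And>n. b \<gamma>0 + e \<le> a (r n) \<gamma>0"
      by (auto simp: not_less dest!: not_eventually_sequentiallyD)
    have \<gamma>0: "\<gamma>0 \<in> \<Gamma>" using r(2)[of 0] a0 b0 e by force
    define w where "w \<gamma> = b \<gamma> + e * indicator {\<gamma>0} \<gamma>" for \<gamma>
    have w: "w \<in> E" unfolding w_def
      using b(1) \<gamma>0 by (intro sequence.add_mem sequence.scale_mem sequence.indicator_mem) auto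
    have w0: "w \<gamma> = 0" if "\<gamma> \<notin> \<Gamma>" for \<gamma> using sequence.support[OF w that] .
    have wp: "0 \<le> w \<gamma>" for \<gamma> using b(3) e by (simp add: w_def)
    \<comment> \<open>The excess of \<open>w\<close> over the norms: zero at \<open>\<gamma>0\<close> by the choice of \<open>r\<close>, and tending to zero
      elsewhere by the lower bound.\<close>
    define v where "v n \<gamma> = max 0 (w \<gamma> - a (r n) \<gamma>)" for n \<gamma>
    have vw: "\<bar>v n \<gamma>\<bar> \<le> \<bar>w \<gamma>\<bar>" for n \<gamma> using a(3)[of "r n" \<gamma>] wp[of \<gamma>] by (simp add: v_def)
    have v: "v n \<in> E" for n using vw w0 a0 by (intro sequence.ideal_mem[OF _ w]) (auto simp: v_def)
    have "tendsto_pointwise v (\<lambda>\<gamma>. 0)"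
      unfolding tendsto_pointwise_def
    proof
      fix \<gamma>
      show "(\<lambda>n. v n \<gamma>) \<longlonglongrightarrow> 0"
      proof (cases "\<gamma> = \<gamma>0")
        case True
        then show ?thesis using r(2) by (simp add: v_def w_def)
      next
        case False
        show ?thesis
        proof (rule order_tendstoI)
          fix e' :: real assume "0 < e'"
          then have "eventually (\<lambda>n. b \<gamma> < a (r n) \<gamma> + e') sequentially"
            using eventually_subseq[OF r(1) lower] by blast
          then show "eventually (\<lambda>n. v n \<gamma> < e') sequentially"
            by eventually_elim (use False \<open>0 < e'\<close> in \<open>simp add: v_def w_def\<close>)
        next
          fix e' :: real assume "e' < 0"
          then show "eventually (\<lambda>n. e' < v n \<gamma>) sequentially"
            by (intro always_eventually) (auto simp: v_def)
        qed
      qed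
    qed
    from sequence.pointwise.kadets_klee_dominated[OF HE v w vw this]
    have "(\<lambda>n. 1 + p (v n)) \<longlonglongrightarrow> 1 + 0" by (intro tendsto_add tendsto_const)
    moreover have "p w \<le> 1 + p (v n)" for n
    proof -
      have "p w \<le> p (\<lambda>\<gamma>. a (r n) \<gamma> + v n \<gamma>)"
        using w0 a(3) wp by (intro sequence.ideal_norm sequence.add_mem a(1) v) (auto simp: v_def)
      also have "\<dots> \<le> p (a (r n)) + p (v n)" using a(1) v by (rule sequence.norm_triangle)
      finally show ?thesis by (simp add: a(2))
    qed
    ultimately have "p w \<le> 1" using LIMSEQ_le_const by force
    moreover have "p b < p w"
    proof -
      have "b \<gamma>0 \<noteq> w \<gamma>0" using e by (simp add: w_def)
      then have "b \<noteq> w" by auto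
      moreover have "b \<gamma> \<le> w \<gamma>" for \<gamma> using e by (simp add: w_def)
      ultimately show ?thesis using SM b(1,3) w unfolding strictly_monotone_def by blast
    qed
    ultimately show False using b(2) by simp
  qed
  show ?thesis
    unfolding tendsto_pointwise_def a_def[symmetric] b_def[symmetric]
  proof
    fix \<gamma>
    show "(\<lambda>n. a n \<gamma>) \<longlonglongrightarrow> b \<gamma>"
    proof (rule tendstoI)
      fix e :: real assume "e > 0"
      from lower[OF this, of \<gamma>] upper[OF this, of \<gamma>]
      show "eventually (\<lambda>n. dist (a n \<gamma>) (b \<gamma>) < e) sequentially"
        by eventually_elim (simp add: dist_real_def abs_less_iff)
    qed
  qed
qed

lemma H_measure_direct_sum:
  assumes HX: "\<And>\<gamma>. \<gamma> \<in> \<Gamma> \<Longrightarrow> H_measure (M \<gamma>) (X \<gamma>) (N \<gamma>)"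
    and HE: "H_pointwise E p" and SM: "strictly_monotone E p"
  shows "H_measure (disjoint_union_measure \<Gamma> M) (direct_sum \<Gamma> X N E) (direct_sum_norm \<Gamma> N p)"
  unfolding kadets_klee_def
proof (intro allI impI, elim conjE)
  fix u f
  assume "\<forall>n. u n \<in> direct_sum \<Gamma> X N E \<and> direct_sum_norm \<Gamma> N p (u n) = 1"
    and f: "f \<in> direct_sum \<Gamma> X N E" "direct_sum_norm \<Gamma> N p f = 1"
    and conv: "tendsto_locally_in_measure (disjoint_union_measure \<Gamma> M) u f"
  then have u: "u n \<in> direct_sum \<Gamma> X N E" "direct_sum_norm \<Gamma> N p (u n) = 1" for n by auto
  define a where "a n = sum_norms \<Gamma> N (u n)" for n
  define b where "b = sum_norms \<Gamma> N f"
  define d where "d n = sum_norms \<Gamma> N (\<lambda>z. u n z - f z)" for n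
  have a: "a n \<in> E" "p (a n) = 1" "0 \<le> a n \<gamma>" for n \<gamma>
    using u sum_norms_mem sum_norms_nonneg by (auto simp: a_def direct_sum_norm_def)
  have b: "b \<in> E" "p b = 1" "0 \<le> b \<gamma>" for \<gamma>
    using f sum_norms_mem sum_norms_nonneg by (auto simp: b_def direct_sum_norm_def)
  have ab: "tendsto_pointwise a b"
    unfolding a_def b_def using HX HE SM u f conv by (rule component_norms_tendsto)
  have index: "(\<lambda>n. p (\<lambda>\<gamma>. a n \<gamma> - b \<gamma>)) \<longlonglongrightarrow> 0"
    using HE a b ab unfolding kadets_klee_def by auto
  have d: "0 \<le> d n \<gamma>" "d n \<gamma> \<le> a n \<gamma> + b \<gamma>" "\<gamma> \<notin> \<Gamma> \<Longrightarrow> d n \<gamma> = 0" "(\<lambda>n. d n \<gamma>) \<longlonglongrightarrow> 0" for n \<gamma>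
  proof -
    have "0 \<le> d n \<gamma> \<and> d n \<gamma> \<le> a n \<gamma> + b \<gamma> \<and> (\<lambda>n. d n \<gamma>) \<longlonglongrightarrow> 0" if \<gamma>: "\<gamma> \<in> \<Gamma>"
    proof -
      interpret S: banach_function_space "M \<gamma>" "X \<gamma>" "N \<gamma>" using \<gamma> by (rule component)
      note mem = section_mem[OF u(1) \<gamma>] section_mem[OF f(1) \<gamma>]
      have "tendsto_locally_in_measure (M \<gamma>) (\<lambda>n t. u n (\<gamma>, t)) (\<lambda>t. f (\<gamma>, t))"
        using conv direct_sum_tendsto_iff[of u f, OF u(1) f(1)] \<gamma> by blast
      moreover have "(\<lambda>n. N \<gamma> (\<lambda>t. u n (\<gamma>, t))) \<longlonglongrightarrow> N \<gamma> (\<lambda>t. f (\<gamma>, t))"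
        using ab \<gamma> by (auto simp: tendsto_pointwise_def a_def b_def sum_norms_def dest!: spec[of _ \<gamma>])
      ultimately have "(\<lambda>n. N \<gamma> (\<lambda>t. u n (\<gamma>, t) - f (\<gamma>, t))) \<longlonglongrightarrow> 0"
        by (intro S.measure.kadets_klee_norm_tendsto HX \<gamma> mem)
      then show ?thesis
        using \<gamma> S.norm_nonneg[OF S.diff_mem[OF mem]] S.norm_diff_triangle[OF mem]
        by (simp add: d_def a_def b_def sum_norms_def)
    qed
    moreover have "d n \<gamma> = 0" if "\<gamma> \<notin> \<Gamma>" for n using that by (simp add: d_def sum_norms_def)
    ultimately show "0 \<le> d n \<gamma>" "d n \<gamma> \<le> a n \<gamma> + b \<gamma>" "\<gamma> \<notin> \<Gamma> \<Longrightarrow> d n \<gamma> = 0" "(\<lambda>n. d n \<gamma>) \<longlonglongrightarrow> 0"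
      using a(3)[of n \<gamma>] b(3)[of \<gamma>] by (cases "\<gamma> \<in> \<Gamma>"; simp)+
  qed
  \<comment> \<open>From \<open>d\<^sub>n \<le> a\<^sub>n + b \<le> \<bar>a\<^sub>n - b\<bar> + 2 b\<close> one gets \<open>d\<^sub>n \<le> \<bar>a\<^sub>n - b\<bar> + min d\<^sub>n (2 b)\<close>: the first
    summand tends to zero in norm by the Kadets--Klee property, the second one by domination.\<close>
  define w where "w \<gamma> = 2 * b \<gamma>" for \<gamma>
  have w: "w \<in> E" unfolding w_def using b(1) by (rule sequence.scale_mem)
  define v where "v n \<gamma> = min (d n \<gamma>) (w \<gamma>)" for n \<gamma>
  have vw: "\<bar>v n \<gamma>\<bar> \<le> \<bar>w \<gamma>\<bar>" and v0: "0 \<le> v n \<gamma>" for n \<gamma>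
    using d(1)[of n \<gamma>] b(3)[of \<gamma>] by (auto simp: v_def w_def)
  have v: "v n \<in> E" for n
    using vw d(3) sequence.support[OF w] by (intro sequence.ideal_mem[OF _ w]) (auto simp: v_def)
  have "tendsto_pointwise v (\<lambda>\<gamma>. 0)"
    unfolding tendsto_pointwise_def
  proof
    fix \<gamma>
    show "(\<lambda>n. v n \<gamma>) \<longlonglongrightarrow> 0"
      by (rule tendsto_sandwich[OF _ _ tendsto_const d(4)[of \<gamma>]])
        (auto simp: v0 intro!: always_eventually, simp add: v_def)
  qed
  then have "(\<lambda>n. p (v n)) \<longlonglongrightarrow> 0"
    by (rule sequence.pointwise.kadets_klee_dominated[OF HE v w vw])
  from tendsto_add[OF index this]
  have bound: "(\<lambda>n. p (\<lambda>\<gamma>. a n \<gamma> - b \<gamma>) + p (v n)) \<longlonglongrightarrow> 0" by simp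
  have "0 \<le> p (d n) \<and> p (d n) \<le> p (\<lambda>\<gamma>. a n \<gamma> - b \<gamma>) + p (v n)" for n
  proof -
    let ?s = "\<lambda>\<gamma>. \<bar>a n \<gamma> - b \<gamma>\<bar> + v n \<gamma>"
    have ab_mem: "(\<lambda>\<gamma>. a n \<gamma> - b \<gamma>) \<in> E" using a(1) b(1) by (rule sequence.diff_mem)
    have s: "?s \<in> E" using sequence.pointwise.abs_mem[OF ab_mem] v by (rule sequence.add_mem)
    have ds: "\<bar>d n \<gamma>\<bar> \<le> \<bar>?s \<gamma>\<bar>" for \<gamma>
      using d(1,2)[of n \<gamma>] v0[of n \<gamma>] by (auto simp: v_def w_def)
    have "d n \<in> E" using d(3) s ds by (rule sequence.ideal_mem)
    moreover have "p (d n) \<le> p ?s" using d(3) s ds by (rule sequence.ideal_norm)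
    moreover have "p ?s \<le> p (\<lambda>\<gamma>. \<bar>a n \<gamma> - b \<gamma>\<bar>) + p (v n)"
      using sequence.pointwise.abs_mem[OF ab_mem] v by (rule sequence.norm_triangle)
    ultimately show ?thesis
      using sequence.norm_nonneg[of "d n"] sequence.norm_abs[OF ab_mem] by simp
  qed
  then have "(\<lambda>n. p (d n)) \<longlonglongrightarrow> 0"
    by (intro tendsto_sandwich[OF _ _ tendsto_const bound]) auto
  then show "(\<lambda>n. direct_sum_norm \<Gamma> N p (\<lambda>z. u n z - f z)) \<longlonglongrightarrow> 0"
    by (simp add: d_def direct_sum_norm_def)
qed

end

theorem theorem5p2p3:
  fixes \<Gamma> :: "'i set"
    and M :: "'i \<Rightarrow> 'a measure"
    and X :: "'i \<Rightarrow> ('a \<Rightarrow> real) set"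
    and N :: "'i \<Rightarrow> ('a \<Rightarrow> real) \<Rightarrow> real"
    and E :: "('i \<Rightarrow> real) set"
    and p :: "('i \<Rightarrow> real) \<Rightarrow> real"
  assumes "countable \<Gamma>"
    and "\<And>\<gamma>. \<gamma> \<in> \<Gamma> \<Longrightarrow> sigma_finite_measure (M \<gamma>)"
    and "\<And>\<gamma>. \<gamma> \<in> \<Gamma> \<Longrightarrow> complete_measure (M \<gamma>)"
    and "\<And>\<gamma>. \<gamma> \<in> \<Gamma> \<Longrightarrow> banach_function_space (M \<gamma>) (X \<gamma>) (N \<gamma>)"
    and "\<And>\<gamma>. \<gamma> \<in> \<Gamma> \<Longrightarrow> infinite_dimensional_mod_AE (M \<gamma>) (X \<gamma>)"
    and "banach_sequence_space \<Gamma> E p"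
    and "monotone_complete E p"
  shows "H_measure (disjoint_union_measure \<Gamma> M) (direct_sum \<Gamma> X N E) (direct_sum_norm \<Gamma> N p)
     \<longleftrightarrow> (\<forall>\<gamma>\<in>\<Gamma>. H_measure (M \<gamma>) (X \<gamma>) (N \<gamma>))
         \<and> H_pointwise E p
         \<and> strictly_monotone E p"
proof -
  interpret direct_sum_of_function_spaces \<Gamma> E p M X N
    using assms(4,6) by (simp add: direct_sum_of_function_spaces_def direct_sum_of_function_spaces_axioms_def)
  have "\<exists>g. (\<forall>n::nat. g n \<in> X \<gamma> \<and> N \<gamma> (g n) = 1 \<and> (\<forall>t. 0 \<le> g n t)) \<and>
      tendsto_locally_in_measure (M \<gamma>) g (\<lambda>t. 0)" if \<gamma>: "\<gamma> \<in> \<Gamma>" for \<gamma>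
  proof -
    interpret S: banach_function_space "M \<gamma>" "X \<gamma>" "N \<gamma>" using \<gamma> by (rule assms(4))
    show ?thesis
      using S.null_sequence_of_unit_vectors[OF assms(2)[OF \<gamma>] assms(5)[OF \<gamma>]] by metis
  qed
  then obtain g where g: "\<And>\<gamma> n. \<gamma> \<in> \<Gamma> \<Longrightarrow> g \<gamma> (n::nat) \<in> X \<gamma> \<and> N \<gamma> (g \<gamma> n) = 1 \<and> (\<forall>t. 0 \<le> g \<gamma> n t)"
    "\<And>\<gamma>. \<gamma> \<in> \<Gamma> \<Longrightarrow> tendsto_locally_in_measure (M \<gamma>) (g \<gamma>) (\<lambda>t. 0)"
    by metis
  show ?thesis
    using H_measure_component H_pointwise_index[of "\<lambda>\<gamma>. g \<gamma> 0"] strictly_monotone_index[of g] g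
      H_measure_direct_sum by blast
qed

end
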